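(* Let $\delta$ be an ordinal of uncountable cofinality, let $A$ be an abelian group and let $n>0$ be an integer. Then $\mathrm{H}^n(\mathcal{U}_\delta,\mathcal{D}_A)$ is (naturally isomorphic to) the group of $n$-coherent families of $A$-valued functions indexed by $\delta$, quotiented by the subgroup of $n$-trivial families of $A$-valued functions indexed by $\delta$, where addition of families is pointwise: $\{\varphi_{\vec\alpha}\}+\{\psi_{\vec\alpha}\}=\{\varphi_{\vec\alpha}+\psi_{\vec\alpha}\}$.
   Context: Ordinals carry the order topology; each ordinal $\alpha<\delta$ is identified with its set of predecessors, an open subset of $\delta$. $\mathcal{U}_\delta=\{\alpha\mid\alpha<\delta\}$ is the initial-segments open cover of $\delta$. $\mathcal{D}_A$ is the presheaf $U\mapsto\bigoplus_U A$ (finitely supported functions $U\to A$, with restriction maps). For an open cover $\mathcal{V}=\{V_\alpha\mid\alpha<\theta\}$ and a presheaf $\mathcal{P}$ of abelian groups, $\mathrm{H}^n(\mathcal{V},\mathcal{P})$ is the $n$-th cohomology of the complex with $L^j=\prod_{\vec\alpha\in[\theta]^{j+1}}\mathcal{P}(V_{\alpha_0}\cap\dots\cap V_{\alpha_j})$ and $d^j f(\vec\alpha)=\sum_{i=0}^{j+1}(-1)^i f(\vec\alpha^i)$ restricted to $V_{\alpha_0}\cap\dots\cap V_{\alpha_{j+1}}$, where $\vec\alpha^i$ is $\vec\alpha$ with its $i$-th coordinate deleted and tuples are listed increasingly. For functions, $f=^*g$ means they differ at only finitely many points (functions with different domains are compared/summed after restriction to the smallest domain). For $n\geq1$, an $A$-valued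 family indexed by (of height) $\delta$ is $\Phi=\{\varphi_{\vec\alpha}:\alpha_0\to A\mid\vec\alpha\in[\delta]^n\}$. $\Phi$ is $n$-coherent if $\sum_{i=0}^n(-1)^i\varphi_{\vec\alpha^i}\restriction\alpha_0=^*0$ for all $\vec\alpha\in[\delta]^{n+1}$. $\Phi$ is $n$-trivial if either $n=1$ and there is $\varphi:\delta\to A$ with $\varphi\restriction\beta=^*\varphi_\beta$ for all $\beta<\delta$, or $n>1$ and there is $\{\psi_{\vec\beta}:\beta_0\to A\mid\vec\beta\in[\delta]^{n-1}\}$ with $\sum_{i=0}^{n-1}(-1)^i\psi_{\vec\alpha^i}\restriction\alpha_0=^*\varphi_{\vec\alpha}$ for all $\vec\alpha\in[\delta]^n$. *)

theory Defs
  imports Complex_Main "HOL-Algebra.FiniteProduct" "HOL-Algebra.Product_Groups"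
begin

unbundle cardinal_syntax

text \<open>
  An ordinal is an element \<open>\<delta>\<close> of an arbitrary well-ordered type; it is identified with its set
  of predecessors \<open>{..<\<delta>}\<close>. Abelian groups are commutative groups of HOL-Algebra, hence written
  multiplicatively: the sum is \<open>finprod\<close>, and multiplication by \<open>(-1)^i\<close> is the integer power
  with exponent \<open>(-1)^i\<close>.
\<close>

section \<open>Cofinality\<close>

definition cofinal_in :: "'o::wellorder \<Rightarrow> 'o set \<Rightarrow> bool" where
  "cofinal_in \<delta> C \<longleftrightarrow> C \<subseteq> {..<\<delta>} \<and> (\<forall>\<alpha><\<delta>. \<exists>\<gamma>\<in>C. \<alpha> \<le> \<gamma>)"

text \<open>The least cardinality of a cofinal subset; it is 0 for \<open>\<delta> = 0\<close> and 1 for successors.\<close>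

definition cofinality :: "'o::wellorder \<Rightarrow> 'o rel" where
  "cofinality \<delta> = |SOME C. cofinal_in \<delta> C \<and> (\<forall>D. cofinal_in \<delta> D \<longrightarrow> |C| \<le>o |D| )|"

definition uncountable_cofinality :: "'o::wellorder \<Rightarrow> bool" where
  "uncountable_cofinality \<delta> \<longleftrightarrow> natLeq <o cofinality \<delta>"

lemma cofinality_attained:
  "\<exists>C. cofinal_in \<delta> C \<and> (\<forall>D. cofinal_in \<delta> D \<longrightarrow> |C| \<le>o |D| ) \<and> cofinality \<delta> = |C|"
proof -
  let ?R = "card_of ` {C. cofinal_in \<delta> C}"
  have "cofinal_in \<delta> {..<\<delta>}"
    by (auto simp: cofinal_in_def)
  then have "?R \<noteq> {}" by blast
  moreover have "\<forall>r\<in>?R. Card_order r"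
    by (auto intro: card_of_Card_order)
  ultimately have "\<exists>r\<in>?R. \<forall>r'\<in>?R. r \<le>o r'"
    by (rule exists_minim_Card_order)
  then have "\<exists>C. cofinal_in \<delta> C \<and> (\<forall>D. cofinal_in \<delta> D \<longrightarrow> |C| \<le>o |D| )"
    by (simp only: bex_simps ball_simps mem_Collect_eq)
  from someI_ex[OF this] show ?thesis
    unfolding cofinality_def by blast
qed


section \<open>Presheaves of abelian groups\<close>

text \<open>\<open>restr P U W\<close> is the restriction map from \<open>sections P U\<close> to \<open>sections P W\<close>, for \<open>W \<subseteq> U\<close>.\<close>

record ('x, 'g) presheaf =
  sections :: "'x set \<Rightarrow> 'g monoid"
  restr :: "'x set \<Rightarrow> 'x set \<Rightarrow> 'g \<Rightarrow> 'g"

locale abelian_presheaf =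
  fixes opens :: "'x set set" and P :: "('x, 'g) presheaf"
  assumes comm_group_sections: "U \<in> opens \<Longrightarrow> comm_group (sections P U)"
    and restr_hom: "\<lbrakk>U \<in> opens; W \<in> opens; W \<subseteq> U\<rbrakk> \<Longrightarrow>
      restr P U W \<in> hom (sections P U) (sections P W)"
    and restr_id: "\<lbrakk>U \<in> opens; f \<in> carrier (sections P U)\<rbrakk> \<Longrightarrow> restr P U U f = f"
    and restr_comp: "\<lbrakk>U \<in> opens; V \<in> opens; W \<in> opens; V \<subseteq> U; W \<subseteq> V;
      f \<in> carrier (sections P U)\<rbrakk> \<Longrightarrow> restr P V W (restr P U V f) = restr P U W f"

text \<open>The presheaf \<open>\<D>\<^sub>A\<close> of finitely supported functions.\<close>

definition finsupp_presheaf :: "('a, 'm) monoid_scheme \<Rightarrow> ('x, 'x \<Rightarrow> 'a) presheaf" where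
  "finsupp_presheaf A = \<lparr>sections = (\<lambda>U. sum_group U (\<lambda>_. A)), restr = (\<lambda>U W f. restrict f W)\<rparr>"

lemma abelian_presheaf_finsupp:
  fixes A :: "('a, 'm) monoid_scheme" and opens :: "'x set set"
  assumes "comm_group A"
  shows "abelian_presheaf opens (finsupp_presheaf A)"
proof -
  interpret A: comm_group A by fact
  have carr: "carrier (sum_group U (\<lambda>_. A)) =
      {f \<in> U \<rightarrow>\<^sub>E carrier A. finite {x \<in> U. f x \<noteq> \<one>\<^bsub>A\<^esub>}}" for U :: "'x set"
    by (simp add: carrier_sum_group A.is_group)
  show ?thesis
  proof (rule abelian_presheaf.intro, goal_cases)
    case (1 U)
    show "comm_group (sections (finsupp_presheaf A) U)"
      unfolding finsupp_presheaf_def presheaf.simps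
    proof (rule group.group_comm_groupI)
      show "group (sum_group U (\<lambda>_. A))"
        by (simp add: A.is_group)
      fix f g
      assume "f \<in> carrier (sum_group U (\<lambda>_. A))" "g \<in> carrier (sum_group U (\<lambda>_. A))"
      then show "f \<otimes>\<^bsub>sum_group U (\<lambda>_. A)\<^esub> g = g \<otimes>\<^bsub>sum_group U (\<lambda>_. A)\<^esub> f"
        by (auto simp: carr PiE_iff A.m_comm intro: restrict_ext)
    qed
  next
    case (2 U W)
    have "finite {x \<in> W. f x \<noteq> \<one>\<^bsub>A\<^esub>}" if "finite {x \<in> U. f x \<noteq> \<one>\<^bsub>A\<^esub>}" for f
      using that \<open>W \<subseteq> U\<close> by (auto elim: rev_finite_subset)
    then have "restrict f W \<in> carrier (sum_group W (\<lambda>_. A))"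
      if "f \<in> carrier (sum_group U (\<lambda>_. A))" for f
      using that \<open>W \<subseteq> U\<close> unfolding carr by (auto simp: PiE_iff cong: conj_cong)
    moreover have "restrict (\<lambda>x\<in>U. f x \<otimes>\<^bsub>A\<^esub> g x) W =
        (\<lambda>x\<in>W. restrict f W x \<otimes>\<^bsub>A\<^esub> restrict g W x)" for f g
      using \<open>W \<subseteq> U\<close> by (auto simp: fun_eq_iff)
    ultimately show ?case
      unfolding finsupp_presheaf_def presheaf.simps by (intro homI) simp_all
  next
    case (3 U f)
    then show ?case
      by (simp add: finsupp_presheaf_def carr PiE_iff extensional_restrict)
  next
    case (4 U V W f)
    then show ?case
      by (simp add: finsupp_presheaf_def restrict_restrict Int_absorb1)
  qed
qed


section \<open>Cohomology of a cover\<close>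

text \<open>\<open>[\<theta>]\<^sup>n\<close>, its elements being listed increasingly.\<close>

definition tuples :: "'o::wellorder \<Rightarrow> nat \<Rightarrow> 'o list set" where
  "tuples \<theta> n = {\<alpha>. length \<alpha> = n \<and> sorted_wrt (<) \<alpha> \<and> set \<alpha> \<subseteq> {..<\<theta>}}"

definition face :: "nat \<Rightarrow> 'o list \<Rightarrow> 'o list" where
  "face i \<alpha> = take i \<alpha> @ drop (Suc i) \<alpha>"

text \<open>
  A cover is a family \<open>V\<close> of open sets, indexed by the ordinal \<open>\<theta>\<close>. The topology enters the
  cochain complex only through the sets \<open>V \<alpha>\<close>, so it is not a parameter below.
\<close>

definition cover_meet :: "('o \<Rightarrow> 'x set) \<Rightarrow> 'o list \<Rightarrow> 'x set" where
  "cover_meet V \<alpha> = (\<Inter>\<beta>\<in>set \<alpha>. V \<beta>)"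

definition cochains ::
  "'o::wellorder \<Rightarrow> ('o \<Rightarrow> 'x set) \<Rightarrow> ('x, 'g) presheaf \<Rightarrow> nat \<Rightarrow> ('o list \<Rightarrow> 'g) monoid" where
  "cochains \<theta> V P j = product_group (tuples \<theta> (j + 1)) (\<lambda>\<alpha>. sections P (cover_meet V \<alpha>))"

definition differential ::
  "'o::wellorder \<Rightarrow> ('o \<Rightarrow> 'x set) \<Rightarrow> ('x, 'g) presheaf \<Rightarrow> nat \<Rightarrow> ('o list \<Rightarrow> 'g) \<Rightarrow> 'o list \<Rightarrow> 'g" where
  "differential \<theta> V P j f = (\<lambda>\<alpha>\<in>tuples \<theta> (j + 2).
     finprod (sections P (cover_meet V \<alpha>))
       (\<lambda>i. restr P (cover_meet V (face i \<alpha>)) (cover_meet V \<alpha>) (f (face i \<alpha>))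
              [^]\<^bsub>sections P (cover_meet V \<alpha>)\<^esub> ((-1) ^ i :: int))
       {0..j + 1})"

definition cocycle_group ::
  "'o::wellorder \<Rightarrow> ('o \<Rightarrow> 'x set) \<Rightarrow> ('x, 'g) presheaf \<Rightarrow> nat \<Rightarrow> ('o list \<Rightarrow> 'g) monoid" where
  "cocycle_group \<theta> V P n = (cochains \<theta> V P n)
     \<lparr>carrier := kernel (cochains \<theta> V P n) (cochains \<theta> V P (n + 1)) (differential \<theta> V P n)\<rparr>"

definition coboundaries ::
  "'o::wellorder \<Rightarrow> ('o \<Rightarrow> 'x set) \<Rightarrow> ('x, 'g) presheaf \<Rightarrow> nat \<Rightarrow> ('o list \<Rightarrow> 'g) set" where
  "coboundaries \<theta> V P n =
     (if n = 0 then {\<one>\<^bsub>cochains \<theta> V P 0\<^esub>}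
      else differential \<theta> V P (n - 1) ` carrier (cochains \<theta> V P (n - 1)))"

definition cohomology ::
  "'o::wellorder \<Rightarrow> ('o \<Rightarrow> 'x set) \<Rightarrow> ('x, 'g) presheaf \<Rightarrow> nat \<Rightarrow> ('o list \<Rightarrow> 'g) set monoid" where
  "cohomology \<theta> V P n = cocycle_group \<theta> V P n Mod coboundaries \<theta> V P n"

text \<open>The cover \<open>\<U>\<^sub>\<delta>\<close>, as a family indexed by the ordinals below \<open>\<delta>\<close>.\<close>

definition initial_segments :: "'o::wellorder \<Rightarrow> 'o set" where
  "initial_segments \<alpha> = {..<\<alpha>}"

lemma open_initial_segment:
  "open (initial_segments (\<alpha> :: 'o::{wellorder, order_topology}))"
  by (simp add: initial_segments_def)

lemma initial_segments_cover:
  assumes "uncountable_cofinality \<delta>"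
  shows "(\<Union>\<alpha>\<in>{..<\<delta>}. initial_segments \<alpha>) = {..<\<delta>}"
proof
  show "(\<Union>\<alpha>\<in>{..<\<delta>}. initial_segments \<alpha>) \<subseteq> {..<\<delta>}"
    by (auto simp: initial_segments_def)
  show "{..<\<delta>} \<subseteq> (\<Union>\<alpha>\<in>{..<\<delta>}. initial_segments \<alpha>)"
  proof (rule ccontr)
    assume "\<not> ?thesis"
    then obtain \<beta> where "\<beta> < \<delta>" and "\<forall>\<alpha><\<delta>. \<alpha> \<le> \<beta>"
      unfolding initial_segments_def by (force simp: not_less)
    then have c: "cofinal_in \<delta> {\<beta>}"
      by (auto simp: cofinal_in_def)
    obtain C where C: "\<forall>D. cofinal_in \<delta> D \<longrightarrow> |C| \<le>o |D|" "cofinality \<delta> = |C|"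
      using cofinality_attained by blast
    have "natLeq <o |C|"
      using assms C(2) by (simp add: uncountable_cofinality_def)
    moreover have "|C| \<le>o |{\<beta>}|"
      using C c by blast
    ultimately have "natLeq <o |{\<beta>}|"
      by (rule ordLess_ordLeq_trans)
    moreover have "|{\<beta>}| <o natLeq"
      by (simp flip: finite_iff_ordLess_natLeq)
    ultimately show False
      by (meson not_ordLess_ordLeq ordLess_imp_ordLeq)
  qed
qed


section \<open>Coherent and trivial families\<close>

text \<open>
  \<open>f =\<^sup>* g\<close> on the domain \<open>U\<close>. Functions with larger domains are thereby restricted to \<open>U\<close>.
\<close>

definition almost_eq :: "'x set \<Rightarrow> ('x \<Rightarrow> 'a) \<Rightarrow> ('x \<Rightarrow> 'a) \<Rightarrow> bool" where
  "almost_eq U f g \<longleftrightarrow> finite {x \<in> U. f x \<noteq> g x}"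

text \<open>Since tuples increase, \<open>hd \<alpha>\<close> is the least entry \<open>\<alpha>\<^sub>0\<close>.\<close>

definition family_group ::
  "'o::wellorder \<Rightarrow> ('a, 'm) monoid_scheme \<Rightarrow> nat \<Rightarrow> ('o list \<Rightarrow> 'o \<Rightarrow> 'a) monoid" where
  "family_group \<delta> A n = product_group (tuples \<delta> n) (\<lambda>\<alpha>. product_group {..<hd \<alpha>} (\<lambda>_. A))"

definition alternating_sum ::
  "('a, 'm) monoid_scheme \<Rightarrow> ('o list \<Rightarrow> 'o \<Rightarrow> 'a) \<Rightarrow> 'o list \<Rightarrow> 'o \<Rightarrow> 'a" where
  "alternating_sum A \<Phi> \<alpha> =
     (\<lambda>\<gamma>. finprod A (\<lambda>i. \<Phi> (face i \<alpha>) \<gamma> [^]\<^bsub>A\<^esub> ((-1) ^ i :: int)) {..<length \<alpha>})"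

definition n_coherent ::
  "'o::wellorder \<Rightarrow> ('a, 'm) monoid_scheme \<Rightarrow> nat \<Rightarrow> ('o list \<Rightarrow> 'o \<Rightarrow> 'a) \<Rightarrow> bool" where
  "n_coherent \<delta> A n \<Phi> \<longleftrightarrow>
     (\<forall>\<alpha>\<in>tuples \<delta> (n + 1). almost_eq {..<hd \<alpha>} (alternating_sum A \<Phi> \<alpha>) (\<lambda>_. \<one>\<^bsub>A\<^esub>))"

definition n_trivial ::
  "'o::wellorder \<Rightarrow> ('a, 'm) monoid_scheme \<Rightarrow> nat \<Rightarrow> ('o list \<Rightarrow> 'o \<Rightarrow> 'a) \<Rightarrow> bool" where
  "n_trivial \<delta> A n \<Phi> \<longleftrightarrow>
     n = 1 \<and> (\<exists>\<phi>\<in>{..<\<delta>} \<rightarrow>\<^sub>E carrier A. \<forall>\<beta><\<delta>. almost_eq {..<\<beta>} \<phi> (\<Phi> [\<beta>])) \<or>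
     n > 1 \<and> (\<exists>\<Psi>\<in>carrier (family_group \<delta> A (n - 1)).
       \<forall>\<alpha>\<in>tuples \<delta> n. almost_eq {..<hd \<alpha>} (alternating_sum A \<Psi> \<alpha>) (\<Phi> \<alpha>))"

definition coherent_group ::
  "'o::wellorder \<Rightarrow> ('a, 'm) monoid_scheme \<Rightarrow> nat \<Rightarrow> ('o list \<Rightarrow> 'o \<Rightarrow> 'a) monoid" where
  "coherent_group \<delta> A n =
     (family_group \<delta> A n)\<lparr>carrier := {\<Phi> \<in> carrier (family_group \<delta> A n). n_coherent \<delta> A n \<Phi>}\<rparr>"

definition trivial_families ::
  "'o::wellorder \<Rightarrow> ('a, 'm) monoid_scheme \<Rightarrow> nat \<Rightarrow> ('o list \<Rightarrow> 'o \<Rightarrow> 'a) set" where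
  "trivial_families \<delta> A n = {\<Phi> \<in> carrier (family_group \<delta> A n). n_trivial \<delta> A n \<Phi>}"

definition coherent_mod_trivial ::
  "'o::wellorder \<Rightarrow> ('a, 'm) monoid_scheme \<Rightarrow> nat \<Rightarrow> ('o list \<Rightarrow> 'o \<Rightarrow> 'a) set monoid" where
  "coherent_mod_trivial \<delta> A n = coherent_group \<delta> A n Mod trivial_families \<delta> A n"


section \<open>The natural map\<close>

text \<open>
  The map into \<open>G Mod N\<close> induced by \<open>h\<close> on a quotient group. It is meaningful if all elements of
  the coset \<open>X\<close> are sent by \<open>h\<close> to the same coset of \<open>N\<close>.
\<close>

definition induced :: "('b, 'm) monoid_scheme \<Rightarrow> 'b set \<Rightarrow> ('c \<Rightarrow> 'b) \<Rightarrow> 'c set \<Rightarrow> 'b set" where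
  "induced G N h X = the_elem ((\<lambda>x. N #>\<^bsub>G\<^esub> h x) ` X)"

text \<open>
  The coboundary of a family, taken among all functions. For coherent families its entries are
  finitely supported, so that it is an \<open>n\<close>-cocycle of \<open>\<D>\<^sub>A\<close>; this is the connecting map for
  the inclusion of \<open>\<D>\<^sub>A\<close> into the presheaf of all \<open>A\<close>-valued functions.
\<close>

definition family_coboundary ::
  "'o::wellorder \<Rightarrow> ('a, 'm) monoid_scheme \<Rightarrow> nat \<Rightarrow> ('o list \<Rightarrow> 'o \<Rightarrow> 'a) \<Rightarrow> 'o list \<Rightarrow> 'o \<Rightarrow> 'a" where
  "family_coboundary \<delta> A n \<Phi> = (\<lambda>\<alpha>\<in>tuples \<delta> (n + 1). \<lambda>\<gamma>\<in>{..<hd \<alpha>}. alternating_sum A \<Phi> \<alpha> \<gamma>)"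

definition connecting_map ::
  "'o::wellorder \<Rightarrow> ('a, 'm) monoid_scheme \<Rightarrow> nat
    \<Rightarrow> ('o list \<Rightarrow> 'o \<Rightarrow> 'a) set \<Rightarrow> ('o list \<Rightarrow> 'o \<Rightarrow> 'a) set" where
  "connecting_map \<delta> A n =
     induced (cocycle_group \<delta> initial_segments (finsupp_presheaf A) n)
       (coboundaries \<delta> initial_segments (finsupp_presheaf A) n)
       (family_coboundary \<delta> A n)"

text \<open>The maps induced by a homomorphism \<open>h\<close> of coefficient groups, with target group \<open>B\<close>.\<close>

definition cohomology_coeff_map ::
  "'o::wellorder \<Rightarrow> ('b, 'm) monoid_scheme \<Rightarrow> nat \<Rightarrow> ('a \<Rightarrow> 'b)
    \<Rightarrow> ('o list \<Rightarrow> 'o \<Rightarrow> 'a) set \<Rightarrow> ('o list \<Rightarrow> 'o \<Rightarrow> 'b) set" where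
  "cohomology_coeff_map \<delta> B n h =
     induced (cocycle_group \<delta> initial_segments (finsupp_presheaf B) n)
       (coboundaries \<delta> initial_segments (finsupp_presheaf B) n)
       (\<lambda>f. \<lambda>\<alpha>\<in>tuples \<delta> (n + 1). \<lambda>\<gamma>\<in>cover_meet initial_segments \<alpha>. h (f \<alpha> \<gamma>))"

definition families_coeff_map ::
  "'o::wellorder \<Rightarrow> ('b, 'm) monoid_scheme \<Rightarrow> nat \<Rightarrow> ('a \<Rightarrow> 'b)
    \<Rightarrow> ('o list \<Rightarrow> 'o \<Rightarrow> 'a) set \<Rightarrow> ('o list \<Rightarrow> 'o \<Rightarrow> 'b) set" where
  "families_coeff_map \<delta> B n h =
     induced (coherent_group \<delta> B n) (trivial_families \<delta> B n)
       (\<lambda>\<Phi>. \<lambda>\<alpha>\<in>tuples \<delta> n. \<lambda>\<gamma>\<in>{..<hd \<alpha>}. h (\<Phi> \<alpha> \<gamma>))"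

end

theory Submission
  imports Defs
begin

text \<open>
  Over a single point \<open>\<gamma>\<close> the cochain complex of all functions is that of the full simplex on the
  indices above \<open>\<gamma>\<close>, so it is contracted by the cone over \<open>\<gamma> + 1\<close>. Hence the presheaf of all
  functions is acyclic on the cover, and every \<open>n\<close>-cocycle of finitely supported functions is the
  coboundary of a family of arbitrary functions; that the coboundary has finite supports says
  exactly that the family is coherent. By the same acyclicity, two families have cohomologous
  coboundaries iff they differ by a coboundary of arbitrary functions up to finitely supported
  ones, i.e. by a trivial family.
\<close>

section \<open>Faces of tuples\<close>

text \<open>The obstacle is the bottom of the complex. A family indexed by tuples of length 0 ought
  to be one function on all of \<open>\<delta>\<close>, but \<open>family_group \<delta> A 0\<close>
  has the domain \<open>{..<hd []}\<close>, which is unspecified. Exactness and triviality are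
  therefore phrased with totally defined functions \<open>F\<close> whose values all lie in the
  group: \<open>F []\<close> is the augmentation term, and the two clauses of
  \<open>n_trivial\<close> become one. \<open>extend_by_one\<close> and
  \<open>restrict_family\<close> pass between such functions and families. Totality also lets the
  algebra of alternating sums be done at one fixed point \<open>\<gamma>\<close> and on arbitrary
  lists. The cone vertex is the least available index, so that prepending it to an increasing tuple
  needs no reordering and hence no sign. Since this vertex varies with \<open>\<gamma>\<close>, the
  contraction does not preserve finite supports in general; it contracts the complex of all
  functions without contracting that of \<open>finsupp_presheaf\<close>.\<close>

lemma face_0_Cons [simp]: "face 0 (a # \<alpha>) = \<alpha>"
  and face_Suc_Cons [simp]: "face (Suc i) (a # \<alpha>) = a # face i \<alpha>"
  by (simp_all add: face_def)

lemma set_face_subset: "set (face i \<alpha>) \<subseteq> set \<alpha>"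
  by (auto simp: face_def dest: in_set_takeD in_set_dropD)

lemma face_in_tuples:
  assumes "\<alpha> \<in> tuples \<delta> (Suc n)" and "i \<le> n"
  shows "face i \<alpha> \<in> tuples \<delta> n"
proof -
  have "sorted_wrt (<) (face i \<alpha>)"
  proof -
    have "sorted_wrt (<) (take i \<alpha> @ drop i \<alpha>)"
      using assms(1) by (simp add: tuples_def)
    moreover have "drop (Suc i) \<alpha> = tl (drop i \<alpha>)"
      by (simp add: drop_Suc tl_drop)
    ultimately show ?thesis
      by (cases "drop i \<alpha>") (auto simp: face_def sorted_wrt_append)
  qed
  then show ?thesis
    using assms set_face_subset[of i \<alpha>] by (auto simp: tuples_def face_def)
qed

lemma hd_le_tuple:
  assumes "\<alpha> \<in> tuples \<delta> n" and "\<beta> \<in> set \<alpha>"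
  shows "hd \<alpha> \<le> \<beta>"
  using assms by (cases \<alpha>) (auto simp: tuples_def less_imp_le)

text \<open>Deleting an entry can only raise the minimum, so \<open>{..<hd \<alpha>}\<close> lies in
  the domain attached to every face, and the functions there can be restricted to it. The condition
  \<open>n > 0\<close> excludes the empty face of a singleton.\<close>

lemma hd_le_hd_face:
  assumes "\<alpha> \<in> tuples \<delta> (Suc n)" and "i \<le> n" and "n > 0"
  shows "hd \<alpha> \<le> hd (face i \<alpha>)"
proof -
  have "face i \<alpha> \<noteq> []"
    using face_in_tuples[OF assms(1,2)] assms(3) by (auto simp: tuples_def)
  then show ?thesis
    using set_face_subset[of i \<alpha>] hd_le_tuple[OF assms(1)] by (meson hd_in_set subsetD)
qed

lemma face_tuples:
  assumes "\<alpha> \<in> tuples \<delta> (Suc (Suc m))" "\<gamma> < hd \<alpha>" "i < length \<alpha>"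
  shows "face i \<alpha> \<in> tuples \<delta> (Suc m)" and "\<gamma> < hd (face i \<alpha>)"
proof -
  have i: "i \<le> Suc m"
    using assms(1,3) by (simp add: tuples_def)
  show "face i \<alpha> \<in> tuples \<delta> (Suc m)"
    using face_in_tuples[OF assms(1) i] .
  show "\<gamma> < hd (face i \<alpha>)"
    using hd_le_hd_face[OF assms(1) i] assms(2) by simp
qed

text \<open>The cover is a chain, so a finite intersection is its smallest member. This matches the
  domains of cochains with those of families; the length \<open>Suc n\<close> excludes the empty
  intersection.\<close>

lemma cover_meet_initial_segments:
  assumes "\<alpha> \<in> tuples \<delta> (Suc n)"
  shows "cover_meet initial_segments \<alpha> = {..<hd \<alpha>}"
proof -
  have "hd \<alpha> \<in> set \<alpha>"
    using assms by (cases \<alpha>) (auto simp: tuples_def)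
  then show ?thesis
    using hd_le_tuple[OF assms]
    by (auto simp: cover_meet_def initial_segments_def intro: less_le_trans)
qed


section \<open>Quotients of commutative groups\<close>

lemma (in comm_group) comm_group_carrier_update:
  assumes "subgroup S G"
  shows "comm_group (G\<lparr>carrier := S\<rparr>)"
proof (rule group.group_comm_groupI)
  show "group (G\<lparr>carrier := S\<rparr>)"
    using assms by (simp add: subgroup_imp_group)
qed (use subgroup.subset[OF assms] in \<open>auto simp: m_comm subset_iff\<close>)

lemma comm_group_product_group:
  assumes "\<And>i. i \<in> I \<Longrightarrow> comm_group (H i)"
  shows "comm_group (product_group I H)"
proof (rule group.group_comm_groupI)
  show "group (product_group I H)"
    using assms by (simp add: comm_group.axioms)
qed (use assms in \<open>auto simp: PiE_iff comm_monoid.m_comm comm_group.axioms intro!: restrict_ext\<close>)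

text \<open>Serves two homomorphisms: evaluation of sections at a point, and a change of
  coefficients.\<close>

lemma hom_finprod:
  assumes "comm_group H" "comm_group K" and h: "h \<in> hom H K"
    and "finite I" and "\<And>i. i \<in> I \<Longrightarrow> f i \<in> carrier H"
  shows "h (finprod H f I) = finprod K (\<lambda>i. h (f i)) I"
  using assms(4,5)
proof (induction I rule: finite_induct)
  case empty
  interpret H: comm_group H by fact
  interpret K: comm_group K by fact
  show ?case
    using hom_one[OF h H.is_group K.is_group] by simp
next
  case (insert i I)
  interpret H: comm_group H by fact
  interpret K: comm_group K by fact
  have "h (f j) \<in> carrier K" if "j \<in> insert i I" for j
    using h insert.prems[OF that] by (auto simp: hom_def)
  then show ?case
    using insert h by (simp add: hom_mult Pi_iff)
qed

lemma (in group_hom) subgroup_vimage: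
  assumes "subgroup S H"
  shows "subgroup {x \<in> carrier G. h x \<in> S} G"
  by (rule G.subgroupI) (use assms in \<open>auto simp: subgroup.one_closed subgroup.m_closed
    subgroup.m_inv_closed intro: exI[of _ "\<one>\<^bsub>G\<^esub>"]\<close>)

text \<open>All elements of \<open>N #> x\<close> have the same image coset because \<open>h\<close>
  maps \<open>N\<close> into \<open>K\<close>, and \<open>\<one> \<in> N\<close> makes the coset
  nonempty; so \<open>the_elem\<close> in \<open>induced\<close> is applied to a singleton.\<close>

lemma (in group_hom) induced_coset:
  assumes K: "subgroup K H" and N: "N \<subseteq> carrier G" "\<one>\<^bsub>G\<^esub> \<in> N" "h ` N \<subseteq> K"
    and x: "x \<in> carrier G"
  shows "induced H K h (N #>\<^bsub>G\<^esub> x) = K #>\<^bsub>H\<^esub> h x"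
proof -
  have *: "K #>\<^bsub>H\<^esub> h (y \<otimes>\<^bsub>G\<^esub> x) = K #>\<^bsub>H\<^esub> h x" if "y \<in> N" for y
  proof -
    have y: "y \<in> carrier G" "h y \<in> K"
      using that N by auto
    have "K #>\<^bsub>H\<^esub> h (y \<otimes>\<^bsub>G\<^esub> x) = (K #>\<^bsub>H\<^esub> h y) #>\<^bsub>H\<^esub> h x"
      using y x subgroup.subset[OF K] by (simp add: H.coset_mult_assoc)
    also have "K #>\<^bsub>H\<^esub> h y = K"
      using y K by (simp add: H.coset_join2)
    finally show ?thesis .
  qed
  have "N #>\<^bsub>G\<^esub> x = (\<lambda>y. y \<otimes>\<^bsub>G\<^esub> x) ` N"
    by (auto simp: r_coset_def)
  then have "(\<lambda>y. K #>\<^bsub>H\<^esub> h y) ` (N #>\<^bsub>G\<^esub> x) = {K #>\<^bsub>H\<^esub> h x}"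
    using N(2) * by (auto simp: image_image image_constant_conv cong: image_cong_simp)
  then show ?thesis
    by (simp add: induced_def)
qed

text \<open>The first isomorphism theorem for \<open>h\<close> followed by the quotient map to
  \<open>H Mod K\<close>: the kernel of this composite is the preimage of \<open>K\<close>.\<close>

lemma (in group_hom) induced_iso:
  assumes K: "K \<lhd> H" and surj: "h ` carrier G = carrier H"
  shows "induced H K h \<in> iso (G Mod {x \<in> carrier G. h x \<in> K}) (H Mod K)"
proof -
  interpret K: normal K H by fact
  let ?q = "\<lambda>x. K #>\<^bsub>H\<^esub> h x"
  have "?q \<in> hom G (H Mod K)"
    using Group.hom_compose[OF homh K.r_coset_hom_Mod] by (simp add: comp_def)
  then interpret q: group_hom G "H Mod K" ?q
    by (intro group_hom.intro group_hom_axioms.intro G.is_group K.factorgroup_is_group)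
  have "?q ` carrier G = carrier (H Mod K)"
    using arg_cong[OF surj, of "image (\<lambda>y. K #>\<^bsub>H\<^esub> y)"] by (auto simp: FactGroup_def RCOSETS_def image_image)
  moreover have "?q x = K \<longleftrightarrow> h x \<in> K" if "x \<in> carrier G" for x
    using that K.subgroup_axioms by (meson H.coset_join1 H.coset_join2 hom_closed)
  then have "kernel G (H Mod K) ?q = {x \<in> carrier G. h x \<in> K}"
    unfolding kernel_def FactGroup_def by (intro Collect_cong) auto
  ultimately show ?thesis
    using q.FactGroup_iso_set by (simp add: induced_def[abs_def])
qed

section \<open>Alternating sums\<close>

text \<open>Truncation to the extensional representative that \<open>family_group\<close> demands.
  The coefficient maps have the same shape, with \<open>F\<close> a family composed with a
  homomorphism.\<close>

definition restrict_family ::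
  "'o::wellorder \<Rightarrow> nat \<Rightarrow> ('o list \<Rightarrow> 'o \<Rightarrow> 'a) \<Rightarrow> 'o list \<Rightarrow> 'o \<Rightarrow> 'a" where
  "restrict_family \<delta> n F = (\<lambda>\<alpha>\<in>tuples \<delta> n. \<lambda>\<gamma>\<in>{..<hd \<alpha>}. F \<alpha> \<gamma>)"

context comm_group
begin

lemma alternating_sum_Nil [simp]: "alternating_sum G F [] \<gamma> = \<one>"
  by (simp add: alternating_sum_def)

lemma alternating_sum_cong:
  assumes "\<And>i. i < length \<alpha> \<Longrightarrow> F (face i \<alpha>) \<gamma> = F' (face i \<alpha>) \<gamma>'"
    and "\<And>i. i < length \<alpha> \<Longrightarrow> F' (face i \<alpha>) \<gamma>' \<in> carrier G"
  shows "alternating_sum G F \<alpha> \<gamma> = alternating_sum G F' \<alpha> \<gamma>'"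
  unfolding alternating_sum_def by (rule finprod_cong') (use assms in auto)

lemma alternating_sum_closed:
  assumes "\<And>i. i < length \<alpha> \<Longrightarrow> F (face i \<alpha>) \<gamma> \<in> carrier G"
  shows "alternating_sum G F \<alpha> \<gamma> \<in> carrier G"
  unfolding alternating_sum_def by (rule finprod_closed) (use assms in auto)

lemma alternating_sum_one: "alternating_sum G (\<lambda>_ _. \<one>) \<alpha> \<gamma> = \<one>"
  by (simp add: alternating_sum_def)

lemma alternating_sum_mult:
  assumes "\<And>i. i < length \<alpha> \<Longrightarrow> F (face i \<alpha>) \<gamma> \<in> carrier G"
    and "\<And>i. i < length \<alpha> \<Longrightarrow> F' (face i \<alpha>) \<gamma> \<in> carrier G"
  shows "alternating_sum G (\<lambda>\<beta> \<gamma>. F \<beta> \<gamma> \<otimes> F' \<beta> \<gamma>) \<alpha> \<gamma>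
    = alternating_sum G F \<alpha> \<gamma> \<otimes> alternating_sum G F' \<alpha> \<gamma>"
proof -
  have "alternating_sum G (\<lambda>\<beta> \<gamma>. F \<beta> \<gamma> \<otimes> F' \<beta> \<gamma>) \<alpha> \<gamma> =
    finprod G (\<lambda>i. F (face i \<alpha>) \<gamma> [^] ((-1) ^ i :: int) \<otimes> F' (face i \<alpha>) \<gamma> [^] ((-1) ^ i :: int))
      {..<length \<alpha>}"
    unfolding alternating_sum_def
    by (rule finprod_cong') (use assms in \<open>auto simp: int_pow_distrib\<close>)
  also have "\<dots> = alternating_sum G F \<alpha> \<gamma> \<otimes> alternating_sum G F' \<alpha> \<gamma>"
    unfolding alternating_sum_def by (rule finprod_multf) (use assms in auto)
  finally show ?thesis .
qed

lemma alternating_sum_inv: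
  assumes "\<And>i. i < length \<alpha> \<Longrightarrow> F (face i \<alpha>) \<gamma> \<in> carrier G"
  shows "alternating_sum G (\<lambda>\<beta> \<gamma>. inv F \<beta> \<gamma>) \<alpha> \<gamma> = inv alternating_sum G F \<alpha> \<gamma>"
proof -
  have "alternating_sum G (\<lambda>\<beta> \<gamma>. inv F \<beta> \<gamma>) \<alpha> \<gamma> \<otimes> alternating_sum G F \<alpha> \<gamma>
      = alternating_sum G (\<lambda>\<beta> \<gamma>. inv F \<beta> \<gamma> \<otimes> F \<beta> \<gamma>) \<alpha> \<gamma>"
    using assms by (simp add: alternating_sum_mult)
  also have "\<dots> = alternating_sum G (\<lambda>_ _. \<one>) \<alpha> \<gamma>"
    using assms by (intro alternating_sum_cong) auto
  also have "\<dots> = \<one>"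
    by (rule alternating_sum_one)
  finally show ?thesis
    using assms by (intro inv_equality[symmetric] alternating_sum_closed) auto
qed

text \<open>Face 0 drops the new head \<open>a\<close>; every other face keeps it and has its index
  shifted by one, which flips the sign and gives the inverse. This recursion carries both the
  square-zero law and the contraction.\<close>

lemma alternating_sum_Cons:
  assumes "F \<alpha> \<gamma> \<in> carrier G"
    and "\<And>i. i < length \<alpha> \<Longrightarrow> F (a # face i \<alpha>) \<gamma> \<in> carrier G"
  shows "alternating_sum G F (a # \<alpha>) \<gamma> =
    F \<alpha> \<gamma> \<otimes> inv alternating_sum G (\<lambda>\<beta>. F (a # \<beta>)) \<alpha> \<gamma>"
proof -
  let ?f = "\<lambda>i. F (face i (a # \<alpha>)) \<gamma> [^] ((-1) ^ i :: int)"
  have f: "?f \<in> insert 0 (Suc ` {..<length \<alpha>}) \<rightarrow> carrier G"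
    using assms by auto
  have "alternating_sum G F (a # \<alpha>) \<gamma> = finprod G ?f (insert 0 (Suc ` {..<length \<alpha>}))"
    by (simp only: alternating_sum_def length_Cons lessThan_Suc_eq_insert_0)
  also have "\<dots> = F \<alpha> \<gamma> \<otimes> finprod G ?f (Suc ` {..<length \<alpha>})"
    using f assms by (subst finprod_insert) auto
  also have "finprod G ?f (Suc ` {..<length \<alpha>}) = finprod G (\<lambda>i. ?f (Suc i)) {..<length \<alpha>}"
    using f by (subst finprod_reindex) auto
  also have "\<dots> = alternating_sum G (\<lambda>\<beta> \<gamma>. inv F (a # \<beta>) \<gamma>) \<alpha> \<gamma>"
    unfolding alternating_sum_def
    by (rule finprod_cong') (use assms in \<open>auto simp: int_pow_neg int_pow_inv\<close>)
  also have "\<dots> = inv alternating_sum G (\<lambda>\<beta>. F (a # \<beta>)) \<alpha> \<gamma>"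
    using assms alternating_sum_inv[where F = "\<lambda>\<beta>. F (a # \<beta>)"] by simp
  finally show ?thesis .
qed

text \<open>Induction on the tuple in place of the usual pairing of double faces. Additively, with
  \<open>d\<close> the alternating sum and \<open>F' \<beta> = F (a # \<beta>)\<close>, the
  recursion gives \<open>ddF (a # \<alpha>) = dF \<alpha> - (dF \<alpha> - ddF' \<alpha>)\<close>,
  and \<open>ddF' \<alpha>\<close> vanishes by the hypothesis for \<open>F'\<close>; hence
  \<open>F\<close> must be arbitrary in the induction.\<close>

lemma alternating_sum_alternating_sum:
  assumes "\<And>\<beta>. F \<beta> \<gamma> \<in> carrier G"
  shows "alternating_sum G (alternating_sum G F) \<alpha> \<gamma> = \<one>"
  using assms
proof (induction \<alpha> arbitrary: F)
  case Nil
  show ?case by simp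
next
  case (Cons a \<alpha>)
  let ?F = "\<lambda>\<beta>. F (a # \<beta>)"
  have [simp]: "alternating_sum G F \<beta> \<gamma> \<in> carrier G" "alternating_sum G ?F \<beta> \<gamma> \<in> carrier G" for \<beta>
    using Cons.prems by (auto intro: alternating_sum_closed)
  have "alternating_sum G (\<lambda>\<beta>. alternating_sum G F (a # \<beta>)) \<alpha> \<gamma>
      = alternating_sum G (\<lambda>\<beta> \<gamma>. F \<beta> \<gamma> \<otimes> inv alternating_sum G ?F \<beta> \<gamma>) \<alpha> \<gamma>"
    by (rule alternating_sum_cong) (use Cons.prems in \<open>auto simp: alternating_sum_Cons\<close>)
  also have "\<dots> = alternating_sum G F \<alpha> \<gamma> \<otimes> inv alternating_sum G (alternating_sum G ?F) \<alpha> \<gamma>"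
    using Cons.prems by (simp add: alternating_sum_mult alternating_sum_inv)
  also have "\<dots> = alternating_sum G F \<alpha> \<gamma>"
    using Cons.IH[of ?F] Cons.prems by simp
  finally show ?case
    by (simp add: alternating_sum_Cons)
qed

text \<open>
  Contracting homotopy onto the vertex \<open>w \<gamma>\<close>. It is only applied where \<open>w \<gamma>\<close> is at most the
  first entry, so that prepending it never breaks the order.
\<close>

definition cone :: "('o \<Rightarrow> 'o) \<Rightarrow> ('o list \<Rightarrow> 'o \<Rightarrow> 'a) \<Rightarrow> 'o list \<Rightarrow> 'o \<Rightarrow> 'a" where
  "cone w F \<beta> \<gamma> = (if \<beta> \<noteq> [] \<and> hd \<beta> = w \<gamma> then \<one> else F (w \<gamma> # \<beta>) \<gamma>)"

text \<open>If the vertex is the head of \<open>\<alpha>\<close>, every face but face 0 still starts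
  with it, where the cone is \<open>\<one>\<close> as on a degenerate simplex; face 0 restores
  \<open>\<alpha>\<close> itself, with sign +. If the vertex is smaller, no face starts with it, and
  the cocycle condition at \<open>w \<gamma> # \<alpha>\<close> expresses
  \<open>F \<alpha> \<gamma>\<close> as the alternating sum of the cone.\<close>

lemma alternating_sum_cone:
  fixes \<alpha> :: "'o::linorder list"
  assumes F: "\<And>\<beta>. F \<beta> \<gamma> \<in> carrier G" and \<alpha>: "sorted_wrt (<) \<alpha>" "\<alpha> \<noteq> []" "w \<gamma> \<le> hd \<alpha>"
    and cocycle: "w \<gamma> < hd \<alpha> \<Longrightarrow> alternating_sum G F (w \<gamma> # \<alpha>) \<gamma> = \<one>"
  shows "alternating_sum G (cone w F) \<alpha> \<gamma> = F \<alpha> \<gamma>"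
proof -
  have cone [simp]: "cone w F \<beta> \<gamma> \<in> carrier G" for \<beta>
    using F by (simp add: cone_def)
  obtain a \<tau> where \<alpha>_eq: "\<alpha> = a # \<tau>"
    using \<alpha>(2) by (cases \<alpha>) auto
  show ?thesis
  proof (cases "w \<gamma> = a")
    case True
    have "a \<notin> set \<tau>"
      using \<alpha>(1) \<alpha>_eq by auto
    then have "cone w F \<tau> \<gamma> = F \<alpha> \<gamma>"
      using True \<alpha>_eq by (cases \<tau>) (auto simp: cone_def)
    moreover have "alternating_sum G (\<lambda>\<beta>. cone w F (a # \<beta>)) \<tau> \<gamma> = alternating_sum G (\<lambda>_ _. \<one>) \<tau> \<gamma>"
      by (rule alternating_sum_cong) (use True in \<open>auto simp: cone_def\<close>)
    ultimately show ?thesis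
      using F by (simp add: \<alpha>_eq alternating_sum_Cons alternating_sum_one)
  next
    case False
    then have less: "w \<gamma> < hd \<alpha>" and notin: "w \<gamma> \<notin> set \<alpha>"
      using \<alpha> \<alpha>_eq by auto
    have [simp]: "alternating_sum G (\<lambda>\<beta>. F (w \<gamma> # \<beta>)) \<alpha> \<gamma> \<in> carrier G"
      using F by (intro alternating_sum_closed)
    have "F \<alpha> \<gamma> \<otimes> inv alternating_sum G (\<lambda>\<beta>. F (w \<gamma> # \<beta>)) \<alpha> \<gamma> = \<one>"
      using cocycle[OF less] F by (simp add: alternating_sum_Cons)
    then have "F \<alpha> \<gamma> = alternating_sum G (\<lambda>\<beta>. F (w \<gamma> # \<beta>)) \<alpha> \<gamma>"
      using F by (metis \<open>alternating_sum G (\<lambda>\<beta>. F (w \<gamma> # \<beta>)) \<alpha> \<gamma> \<in> carrier G\<close> inv_closed inv_equality inv_inv)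
    also have "\<dots> = alternating_sum G (cone w F) \<alpha> \<gamma>"
    proof (rule alternating_sum_cong)
      fix i
      have "face i \<alpha> \<noteq> [] \<Longrightarrow> hd (face i \<alpha>) \<noteq> w \<gamma>"
        using notin set_face_subset[of i \<alpha>] by (metis hd_in_set subsetD)
      then show "F (w \<gamma> # face i \<alpha>) \<gamma> = cone w F (face i \<alpha>) \<gamma>"
        by (auto simp: cone_def)
    qed simp
    finally show ?thesis by simp
  qed
qed


section \<open>Families\<close>

text \<open>Here \<open>n\<close> is the tuple length, so for \<open>n > 0\<close> these are the
  cochains of degree \<open>n - 1\<close>.\<close>

definition finsupp_families :: "'o::wellorder \<Rightarrow> nat \<Rightarrow> ('o list \<Rightarrow> 'o \<Rightarrow> 'a) set" where
  "finsupp_families \<delta> n = (\<Pi>\<^sub>E \<alpha>\<in>tuples \<delta> n. carrier (sum_group {..<hd \<alpha>} (\<lambda>_. G)))"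

lemma family_group_iff:
  "\<Phi> \<in> carrier (family_group \<delta> G n) \<longleftrightarrow> \<Phi> \<in> extensional (tuples \<delta> n) \<and>
    (\<forall>\<alpha>\<in>tuples \<delta> n. \<Phi> \<alpha> \<in> extensional {..<hd \<alpha>} \<and> (\<forall>\<gamma><hd \<alpha>. \<Phi> \<alpha> \<gamma> \<in> carrier G))"
  by (auto simp: family_group_def PiE_iff)

lemma finsupp_families_iff:
  "\<Phi> \<in> finsupp_families \<delta> n \<longleftrightarrow> \<Phi> \<in> carrier (family_group \<delta> G n) \<and>
    (\<forall>\<alpha>\<in>tuples \<delta> n. almost_eq {..<hd \<alpha>} (\<Phi> \<alpha>) (\<lambda>_. \<one>))"
  unfolding finsupp_families_def family_group_iff almost_eq_def
  by (auto simp: PiE_iff carrier_sum_group)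

lemma finsupp_family:
  "\<Phi> \<in> finsupp_families \<delta> n \<Longrightarrow> \<Phi> \<in> carrier (family_group \<delta> G n)"
  by (simp add: finsupp_families_iff)

lemma family_eqI:
  assumes "\<Phi> \<in> carrier (family_group \<delta> G n)" "\<Psi> \<in> carrier (family_group \<delta> G n)"
    and "\<And>\<alpha> \<gamma>. \<alpha> \<in> tuples \<delta> n \<Longrightarrow> \<gamma> < hd \<alpha> \<Longrightarrow> \<Phi> \<alpha> \<gamma> = \<Psi> \<alpha> \<gamma>"
  shows "\<Phi> = \<Psi>"
proof (rule extensionalityI[of _ "tuples \<delta> n"])
  fix \<alpha> assume \<alpha>: "\<alpha> \<in> tuples \<delta> n"
  show "\<Phi> \<alpha> = \<Psi> \<alpha>"
    by (rule extensionalityI[of _ "{..<hd \<alpha>}"]) (use assms \<alpha> in \<open>auto simp: family_group_iff\<close>)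
qed (use assms in \<open>auto simp: family_group_iff\<close>)

lemma comm_group_family_group: "comm_group (family_group \<delta> G n)"
  unfolding family_group_def by (intro comm_group_product_group) (rule comm_group_axioms)

lemma mult_family_group:
  assumes "\<alpha> \<in> tuples \<delta> n" "\<gamma> < hd \<alpha>"
  shows "(\<Phi> \<otimes>\<^bsub>family_group \<delta> G n\<^esub> \<Psi>) \<alpha> \<gamma> = \<Phi> \<alpha> \<gamma> \<otimes> \<Psi> \<alpha> \<gamma>"
  using assms by (simp add: family_group_def)

lemma one_family_group:
  assumes "\<alpha> \<in> tuples \<delta> n" "\<gamma> < hd \<alpha>"
  shows "\<one>\<^bsub>family_group \<delta> G n\<^esub> \<alpha> \<gamma> = \<one>"
  using assms by (simp add: family_group_def)

lemma inv_family_group: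
  assumes "\<Phi> \<in> carrier (family_group \<delta> G n)" "\<alpha> \<in> tuples \<delta> n" "\<gamma> < hd \<alpha>"
  shows "(inv\<^bsub>family_group \<delta> G n\<^esub> \<Phi>) \<alpha> \<gamma> = inv \<Phi> \<alpha> \<gamma>"
  using assms by (auto simp: family_group_def PiE_iff)

lemma subgroup_finsupp_families: "subgroup (finsupp_families \<delta> n) (family_group \<delta> G n)"
proof -
  have "subgroup (carrier (sum_group U (\<lambda>_. G))) (product_group U (\<lambda>_. G))" for U :: "'o set"
    by (simp only: carrier_sum_group is_group subgroup_sum_group)
  then show ?thesis
    unfolding finsupp_families_def family_group_def
    by (subst PiE_subgroup_product_group) auto
qed

lemma family_face_closed:
  assumes "\<Phi> \<in> carrier (family_group \<delta> G (Suc m))"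
    and "\<alpha> \<in> tuples \<delta> (Suc (Suc m))" "\<gamma> < hd \<alpha>" "i < length \<alpha>"
  shows "\<Phi> (face i \<alpha>) \<gamma> \<in> carrier G"
  using assms face_tuples[OF assms(2-4)] by (simp add: family_group_iff)

section \<open>The coboundary on families of arbitrary functions\<close>

lemma family_coboundary_apply:
  assumes "\<alpha> \<in> tuples \<delta> (Suc n)" "\<gamma> < hd \<alpha>"
  shows "family_coboundary \<delta> G n \<Phi> \<alpha> \<gamma> = alternating_sum G \<Phi> \<alpha> \<gamma>"
  using assms by (simp add: family_coboundary_def)

lemma family_coboundary_closed:
  assumes "\<And>\<alpha> \<gamma> i. \<alpha> \<in> tuples \<delta> (Suc n) \<Longrightarrow> \<gamma> < hd \<alpha> \<Longrightarrow> i < length \<alpha> \<Longrightarrow> \<Phi> (face i \<alpha>) \<gamma> \<in> carrier G"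
  shows "family_coboundary \<delta> G n \<Phi> \<in> carrier (family_group \<delta> G (Suc n))"
  using assms by (auto simp: family_group_iff family_coboundary_def intro: alternating_sum_closed)

lemma family_coboundary_hom:
  "family_coboundary \<delta> G (Suc m) \<in> hom (family_group \<delta> G (Suc m)) (family_group \<delta> G (Suc (Suc m)))"
proof (rule homI)
  fix \<Phi> assume \<Phi>: "\<Phi> \<in> carrier (family_group \<delta> G (Suc m))"
  then show D\<Phi>: "family_coboundary \<delta> G (Suc m) \<Phi> \<in> carrier (family_group \<delta> G (Suc (Suc m)))"
    by (intro family_coboundary_closed family_face_closed)
  fix \<Psi> assume \<Psi>: "\<Psi> \<in> carrier (family_group \<delta> G (Suc m))"
  interpret F: comm_group "family_group \<delta> G (Suc m)" by (rule comm_group_family_group)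
  interpret F': comm_group "family_group \<delta> G (Suc (Suc m))" by (rule comm_group_family_group)
  show "family_coboundary \<delta> G (Suc m) (\<Phi> \<otimes>\<^bsub>family_group \<delta> G (Suc m)\<^esub> \<Psi>) =
    family_coboundary \<delta> G (Suc m) \<Phi> \<otimes>\<^bsub>family_group \<delta> G (Suc (Suc m))\<^esub> family_coboundary \<delta> G (Suc m) \<Psi>"
  proof (rule family_eqI)
    fix \<alpha> \<gamma> assume \<alpha>: "\<alpha> \<in> tuples \<delta> (Suc (Suc m))" and \<gamma>: "\<gamma> < hd \<alpha>"
    note face = face_tuples[OF \<alpha> \<gamma>]
    have "alternating_sum G (\<Phi> \<otimes>\<^bsub>family_group \<delta> G (Suc m)\<^esub> \<Psi>) \<alpha> \<gamma>
        = alternating_sum G (\<lambda>\<beta> \<gamma>. \<Phi> \<beta> \<gamma> \<otimes> \<Psi> \<beta> \<gamma>) \<alpha> \<gamma>"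
      by (rule alternating_sum_cong)
        (use \<Phi> \<Psi> \<alpha> \<gamma> face in \<open>auto simp: mult_family_group family_face_closed\<close>)
    also have "\<dots> = alternating_sum G \<Phi> \<alpha> \<gamma> \<otimes> alternating_sum G \<Psi> \<alpha> \<gamma>"
      using \<Phi> \<Psi> \<alpha> \<gamma> by (intro alternating_sum_mult family_face_closed)
    finally show "family_coboundary \<delta> G (Suc m) (\<Phi> \<otimes>\<^bsub>family_group \<delta> G (Suc m)\<^esub> \<Psi>) \<alpha> \<gamma> =
      (family_coboundary \<delta> G (Suc m) \<Phi> \<otimes>\<^bsub>family_group \<delta> G (Suc (Suc m))\<^esub> family_coboundary \<delta> G (Suc m) \<Psi>) \<alpha> \<gamma>"
      using \<alpha> \<gamma> by (simp add: mult_family_group family_coboundary_apply)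
  qed (use \<Phi> \<Psi> D\<Phi> in \<open>auto intro!: F'.m_closed family_coboundary_closed family_face_closed\<close>)
qed

lemma group_hom_family_coboundary:
  "group_hom (family_group \<delta> G (Suc m)) (family_group \<delta> G (Suc (Suc m))) (family_coboundary \<delta> G (Suc m))"
  by (intro group_hom.intro group_hom_axioms.intro family_coboundary_hom
    comm_group.axioms(2)[OF comm_group_family_group])

text \<open>A totally defined \<open>F\<close> admits the case \<open>n = 0\<close>, in which the
  inner coboundary restricts the single function \<open>F []\<close> to each initial segment. Below
  the head of a tuple, the truncation in the inner coboundary is invisible, so the pointwise law
  applies.\<close>

lemma family_coboundary_square:
  assumes "\<And>\<beta> \<gamma>. F \<beta> \<gamma> \<in> carrier G"
  shows "family_coboundary \<delta> G (Suc n) (family_coboundary \<delta> G n F) = \<one>\<^bsub>family_group \<delta> G (Suc (Suc n))\<^esub>"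
proof (rule family_eqI)
  interpret F': comm_group "family_group \<delta> G (Suc (Suc n))" by (rule comm_group_family_group)
  have DF: "family_coboundary \<delta> G n F \<in> carrier (family_group \<delta> G (Suc n))"
    using assms by (intro family_coboundary_closed)
  then show "family_coboundary \<delta> G (Suc n) (family_coboundary \<delta> G n F) \<in> carrier (family_group \<delta> G (Suc (Suc n)))"
    using family_coboundary_hom[of \<delta> n] by (auto simp: hom_def)
  fix \<alpha> \<gamma> assume \<alpha>: "\<alpha> \<in> tuples \<delta> (Suc (Suc n))" and \<gamma>: "\<gamma> < hd \<alpha>"
  note face = face_tuples[OF \<alpha> \<gamma>]
  have "alternating_sum G (family_coboundary \<delta> G n F) \<alpha> \<gamma> = alternating_sum G (alternating_sum G F) \<alpha> \<gamma>"
    by (rule alternating_sum_cong)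
      (use assms \<alpha> \<gamma> face in \<open>auto simp: family_coboundary_apply intro: alternating_sum_closed\<close>)
  then show "family_coboundary \<delta> G (Suc n) (family_coboundary \<delta> G n F) \<alpha> \<gamma> = \<one>\<^bsub>family_group \<delta> G (Suc (Suc n))\<^esub> \<alpha> \<gamma>"
    using assms \<alpha> \<gamma> by (simp add: family_coboundary_apply one_family_group alternating_sum_alternating_sum)
qed (rule group.is_monoid[OF comm_group.axioms(2)[OF comm_group_family_group], THEN monoid.one_closed])

text \<open>Off its domain a family is \<open>undefined\<close>, which may lie outside the group.
  Testing the value instead of the domain keeps \<open>\<delta>\<close> and the tuple length out of
  the definition.\<close>

definition extend_by_one :: "('o list \<Rightarrow> 'o \<Rightarrow> 'a) \<Rightarrow> 'o list \<Rightarrow> 'o \<Rightarrow> 'a" where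
  "extend_by_one \<Phi> \<beta> \<gamma> = (if \<Phi> \<beta> \<gamma> \<in> carrier G then \<Phi> \<beta> \<gamma> else \<one>)"

lemma extend_by_one_closed: "extend_by_one \<Phi> \<beta> \<gamma> \<in> carrier G"
  by (simp add: extend_by_one_def)

lemma alternating_sum_extend_by_one:
  assumes "\<Phi> \<in> carrier (family_group \<delta> G (Suc m))"
    and "\<alpha> \<in> tuples \<delta> (Suc (Suc m))" "\<gamma> < hd \<alpha>"
  shows "alternating_sum G (extend_by_one \<Phi>) \<alpha> \<gamma> = alternating_sum G \<Phi> \<alpha> \<gamma>"
  by (rule alternating_sum_cong) (use family_face_closed[OF assms] in \<open>auto simp: extend_by_one_def\<close>)

lemma family_coboundary_extend_by_one:
  assumes "\<Phi> \<in> carrier (family_group \<delta> G (Suc m))"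
  shows "family_coboundary \<delta> G (Suc m) (extend_by_one \<Phi>) = family_coboundary \<delta> G (Suc m) \<Phi>"
  unfolding family_coboundary_def
  by (intro restrict_ext) (use alternating_sum_extend_by_one[OF assms] in auto)

text \<open>A tuple of length at least 2 and a point below its head only involve faces and points
  that survive the truncation.\<close>

lemma family_coboundary_restrict:
  assumes "\<And>\<beta> \<gamma>. F \<beta> \<gamma> \<in> carrier G"
  shows "restrict_family \<delta> (Suc m) F \<in> carrier (family_group \<delta> G (Suc m))"
    and "family_coboundary \<delta> G (Suc m) (restrict_family \<delta> (Suc m) F) = family_coboundary \<delta> G (Suc m) F"
proof -
  show \<Phi>: "restrict_family \<delta> (Suc m) F \<in> carrier (family_group \<delta> G (Suc m))"
    using assms by (auto simp: family_group_iff restrict_family_def)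
  show "family_coboundary \<delta> G (Suc m) (restrict_family \<delta> (Suc m) F) = family_coboundary \<delta> G (Suc m) F"
  proof (rule family_eqI)
    fix \<alpha> \<gamma> assume \<alpha>: "\<alpha> \<in> tuples \<delta> (Suc (Suc m))" and \<gamma>: "\<gamma> < hd \<alpha>"
    note face = face_tuples[OF \<alpha> \<gamma>]
    show "family_coboundary \<delta> G (Suc m) (restrict_family \<delta> (Suc m) F) \<alpha> \<gamma> = family_coboundary \<delta> G (Suc m) F \<alpha> \<gamma>"
      unfolding family_coboundary_apply[OF \<alpha> \<gamma>]
      by (rule alternating_sum_cong) (use assms face in \<open>auto simp: restrict_family_def\<close>)
  qed (use \<Phi> assms in \<open>auto intro: family_coboundary_closed family_face_closed\<close>)
qed

text \<open>
  The point \<open>\<gamma>\<close> lies in the sets of the cover whose index exceeds \<open>\<gamma>\<close>. They have the least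
  index \<open>\<gamma> + 1\<close>, which serves as cone vertex over \<open>\<gamma>\<close>.
\<close>

lemma family_coboundary_exact:
  assumes \<Phi>: "\<Phi> \<in> carrier (family_group \<delta> G (Suc n))"
    and cocycle: "family_coboundary \<delta> G (Suc n) \<Phi> = \<one>\<^bsub>family_group \<delta> G (Suc (Suc n))\<^esub>"
  obtains F where "\<And>\<beta> \<gamma>. F \<beta> \<gamma> \<in> carrier G" and "family_coboundary \<delta> G n F = \<Phi>"
proof
  let ?w = "\<lambda>\<gamma>. LEAST \<beta>. \<gamma> < \<beta>"
  let ?F = "cone ?w (extend_by_one \<Phi>)"
  show F: "?F \<beta> \<gamma> \<in> carrier G" for \<beta> \<gamma>
    by (simp add: cone_def extend_by_one_closed)
  show "family_coboundary \<delta> G n ?F = \<Phi>"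
  proof (rule family_eqI)
    fix \<alpha> \<gamma> assume \<alpha>: "\<alpha> \<in> tuples \<delta> (Suc n)" and \<gamma>: "\<gamma> < hd \<alpha>"
    \<comment> \<open>\<open>hd \<alpha>\<close> witnesses that some index exceeds
      \<open>\<gamma>\<close>, so the least one exists here. At a point with nothing above it
      \<open>?w\<close> is arbitrary, yet \<open>?F\<close> stays in the carrier.\<close>
    have w: "?w \<gamma> \<le> hd \<alpha>" "\<gamma> < ?w \<gamma>"
      using \<gamma> by (auto intro: Least_le LeastI)
    have \<alpha>': "sorted_wrt (<) \<alpha>" "\<alpha> \<noteq> []" "set \<alpha> \<subseteq> {..<\<delta>}"
      using \<alpha> by (auto simp: tuples_def)
    \<comment> \<open>The cocycle condition speaks only of increasing tuples; with
      \<open>?w \<gamma> = hd \<alpha>\<close> the prepended list would repeat an entry.\<close>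
    have "alternating_sum G (extend_by_one \<Phi>) (?w \<gamma> # \<alpha>) \<gamma> = \<one>" if "?w \<gamma> < hd \<alpha>"
    proof -
      have "?w \<gamma> < \<beta>" if "\<beta> \<in> set \<alpha>" for \<beta>
        using hd_le_tuple[OF \<alpha> that] \<open>?w \<gamma> < hd \<alpha>\<close> by simp
      moreover have "hd \<alpha> < \<delta>"
        using \<alpha>' by (meson hd_in_set lessThan_iff subsetD)
      ultimately have "?w \<gamma> # \<alpha> \<in> tuples \<delta> (Suc (Suc n))"
        using \<alpha> that by (auto simp: tuples_def)
      then show ?thesis
        using arg_cong[OF cocycle, of "\<lambda>\<Psi>. \<Psi> (?w \<gamma> # \<alpha>) \<gamma>"] w(2) \<Phi>
        by (simp add: alternating_sum_extend_by_one one_family_group family_coboundary_apply)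
    qed
    then have "alternating_sum G ?F \<alpha> \<gamma> = extend_by_one \<Phi> \<alpha> \<gamma>"
      by (intro alternating_sum_cone) (use \<alpha>' w extend_by_one_closed in auto)
    then show "family_coboundary \<delta> G n ?F \<alpha> \<gamma> = \<Phi> \<alpha> \<gamma>"
      using \<Phi> \<alpha> \<gamma> by (simp add: family_coboundary_apply extend_by_one_def family_group_iff)
  qed (use F \<Phi> in \<open>auto intro: family_coboundary_closed\<close>)
qed


section \<open>Coherence and triviality in terms of the coboundary\<close>

lemma n_coherent_iff:
  assumes "\<Phi> \<in> carrier (family_group \<delta> G (Suc m))"
  shows "n_coherent \<delta> G (Suc m) \<Phi> \<longleftrightarrow>
    family_coboundary \<delta> G (Suc m) \<Phi> \<in> finsupp_families \<delta> (Suc (Suc m))"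
proof -
  have "family_coboundary \<delta> G (Suc m) \<Phi> \<in> carrier (family_group \<delta> G (Suc (Suc m)))"
    using family_coboundary_hom assms by (rule hom_in_carrier)
  then show ?thesis
    by (simp add: n_coherent_def finsupp_families_iff almost_eq_def family_coboundary_apply
      cong: conj_cong)
qed

text \<open>Merges the two clauses of the definition. On singletons the alternating sum of
  \<open>F\<close> is \<open>F []\<close>, the single trivializing function; on longer tuples
  \<open>F\<close> and a family with the same coboundary are interchangeable.\<close>

lemma n_trivial_iff:
  fixes \<delta> :: "'o::wellorder"
  shows "n_trivial \<delta> G (Suc m) \<Phi> \<longleftrightarrow> (\<exists>F. (\<forall>\<beta> \<gamma>. F \<beta> \<gamma> \<in> carrier G) \<and>
    (\<forall>\<alpha>\<in>tuples \<delta> (Suc m). almost_eq {..<hd \<alpha>} (alternating_sum G F \<alpha>) (\<Phi> \<alpha>)))"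
proof (cases m)
  case 0
  have tuples_1: "\<alpha> \<in> tuples \<delta> (Suc 0) \<longleftrightarrow> (\<exists>\<beta><\<delta>. \<alpha> = [\<beta>])" for \<alpha>
    by (cases \<alpha>) (auto simp: tuples_def)
  have sum_1: "alternating_sum G F [\<beta>] \<gamma> = F [] \<gamma>" if "\<And>\<beta> \<gamma>. F \<beta> \<gamma> \<in> carrier G" for F \<beta> \<gamma>
    using that by (simp add: alternating_sum_Cons)
  show ?thesis
  proof
    assume "n_trivial \<delta> G (Suc m) \<Phi>"
    then obtain \<phi> where \<phi>: "\<phi> \<in> {..<\<delta>} \<rightarrow>\<^sub>E carrier G" "\<forall>\<beta><\<delta>. almost_eq {..<\<beta>} \<phi> (\<Phi> [\<beta>])"
      by (auto simp: n_trivial_def 0)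
    \<comment> \<open>Beyond \<open>\<delta>\<close> the function \<open>\<phi>\<close> is
      \<open>undefined\<close>; the value \<open>\<one>\<close> there keeps \<open>F\<close> in the
      carrier.\<close>
    define F :: "'o list \<Rightarrow> 'o \<Rightarrow> 'a" where "F = (\<lambda>_ \<gamma>. if \<gamma> < \<delta> then \<phi> \<gamma> else \<one>)"
    have F: "F \<beta> \<gamma> \<in> carrier G" for \<beta> \<gamma>
      using \<phi>(1) by (auto simp: F_def)
    moreover have "{\<gamma> \<in> {..<\<beta>}. F [] \<gamma> \<noteq> \<Phi> [\<beta>] \<gamma>} = {\<gamma> \<in> {..<\<beta>}. \<phi> \<gamma> \<noteq> \<Phi> [\<beta>] \<gamma>}" if "\<beta> < \<delta>" for \<beta>
      using that by (auto simp: F_def)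
    ultimately show "\<exists>F. (\<forall>\<beta> \<gamma>. F \<beta> \<gamma> \<in> carrier G) \<and>
        (\<forall>\<alpha>\<in>tuples \<delta> (Suc m). almost_eq {..<hd \<alpha>} (alternating_sum G F \<alpha>) (\<Phi> \<alpha>))"
      using \<phi>(2) by (intro exI[of _ F]) (auto simp: 0 tuples_1 sum_1 almost_eq_def)
  next
    assume "\<exists>F. (\<forall>\<beta> \<gamma>. F \<beta> \<gamma> \<in> carrier G) \<and>
        (\<forall>\<alpha>\<in>tuples \<delta> (Suc m). almost_eq {..<hd \<alpha>} (alternating_sum G F \<alpha>) (\<Phi> \<alpha>))"
    then obtain F where F: "\<And>\<beta> \<gamma>. F \<beta> \<gamma> \<in> carrier G"
        "\<forall>\<alpha>\<in>tuples \<delta> (Suc m). almost_eq {..<hd \<alpha>} (alternating_sum G F \<alpha>) (\<Phi> \<alpha>)"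
      by blast
    have "almost_eq {..<\<beta>} (restrict (F []) {..<\<delta>}) (\<Phi> [\<beta>])" if \<beta>: "\<beta> < \<delta>" for \<beta>
    proof -
      have "[\<beta>] \<in> tuples \<delta> (Suc m)"
        using \<beta> by (simp add: 0 tuples_1)
      then have "almost_eq {..<\<beta>} (alternating_sum G F [\<beta>]) (\<Phi> [\<beta>])"
        using F(2) by force
      then show ?thesis
        using \<beta> F(1) by (auto simp: almost_eq_def sum_1 elim!: rev_finite_subset)
    qed
    moreover have "restrict (F []) {..<\<delta>} \<in> {..<\<delta>} \<rightarrow>\<^sub>E carrier G"
      using F(1) by auto
    ultimately show "n_trivial \<delta> G (Suc m) \<Phi>"
      unfolding n_trivial_def 0
      by (intro disjI1 conjI bexI[of _ "restrict (F []) {..<\<delta>}"]) simp_all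
  qed
next
  case (Suc k)
  \<comment> \<open>The condition sees \<open>F\<close> only through its alternating sums below the
    heads, that is, through its coboundary.\<close>
  have almost_eq_iff: "almost_eq {..<hd \<alpha>} (alternating_sum G F \<alpha>) (\<Phi> \<alpha>) \<longleftrightarrow>
      almost_eq {..<hd \<alpha>} (alternating_sum G F' \<alpha>) (\<Phi> \<alpha>)"
    if "family_coboundary \<delta> G m F = family_coboundary \<delta> G m F'" "\<alpha> \<in> tuples \<delta> (Suc m)" for F F' \<alpha>
  proof -
    have "alternating_sum G F \<alpha> \<gamma> = alternating_sum G F' \<alpha> \<gamma>" if "\<gamma> < hd \<alpha>" for \<gamma>
      using family_coboundary_apply[of \<alpha> \<delta> m \<gamma>] that \<open>\<alpha> \<in> tuples \<delta> (Suc m)\<close>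
        \<open>family_coboundary \<delta> G m F = family_coboundary \<delta> G m F'\<close> by metis
    then show ?thesis
      by (simp add: almost_eq_def cong: conj_cong)
  qed
  show ?thesis
  proof
    assume "n_trivial \<delta> G (Suc m) \<Phi>"
    then obtain \<Psi> where \<Psi>: "\<Psi> \<in> carrier (family_group \<delta> G m)"
        "\<forall>\<alpha>\<in>tuples \<delta> (Suc m). almost_eq {..<hd \<alpha>} (alternating_sum G \<Psi> \<alpha>) (\<Phi> \<alpha>)"
      by (auto simp: n_trivial_def Suc)
    have "\<forall>\<alpha>\<in>tuples \<delta> (Suc m).
        almost_eq {..<hd \<alpha>} (alternating_sum G (extend_by_one \<Psi>) \<alpha>) (\<Phi> \<alpha>)"
      using \<Psi>(2) almost_eq_iff[OF family_coboundary_extend_by_one[OF \<Psi>(1)[unfolded Suc], folded Suc]]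
      by simp
    then show "\<exists>F. (\<forall>\<beta> \<gamma>. F \<beta> \<gamma> \<in> carrier G) \<and>
        (\<forall>\<alpha>\<in>tuples \<delta> (Suc m). almost_eq {..<hd \<alpha>} (alternating_sum G F \<alpha>) (\<Phi> \<alpha>))"
      by (intro exI[of _ "extend_by_one \<Psi>"] conjI) (simp_all add: extend_by_one_closed)
  next
    assume "\<exists>F. (\<forall>\<beta> \<gamma>. F \<beta> \<gamma> \<in> carrier G) \<and>
        (\<forall>\<alpha>\<in>tuples \<delta> (Suc m). almost_eq {..<hd \<alpha>} (alternating_sum G F \<alpha>) (\<Phi> \<alpha>))"
    then obtain F where F: "\<And>\<beta> \<gamma>. F \<beta> \<gamma> \<in> carrier G"
        "\<forall>\<alpha>\<in>tuples \<delta> (Suc m). almost_eq {..<hd \<alpha>} (alternating_sum G F \<alpha>) (\<Phi> \<alpha>)"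
      by blast
    have "\<forall>\<alpha>\<in>tuples \<delta> (Suc m).
        almost_eq {..<hd \<alpha>} (alternating_sum G (restrict_family \<delta> m F) \<alpha>) (\<Phi> \<alpha>)"
      using F(2) almost_eq_iff[OF family_coboundary_restrict(2)[OF F(1), of \<delta> k, folded Suc]] by simp
    then show "n_trivial \<delta> G (Suc m) \<Phi>"
      using family_coboundary_restrict(1)[OF F(1), of \<delta> k] by (auto simp: n_trivial_def Suc)
  qed
qed

text \<open>Additively, with \<open>d\<close> the coboundary: if \<open>F\<close> trivializes
  \<open>\<Phi>\<close>, then \<open>\<Phi> - dF\<close> has finite supports and the same coboundary
  as \<open>\<Phi>\<close>. Conversely, \<open>d\<Phi> = df\<close> makes \<open>\<Phi> - f\<close>
  a cocycle, exactness writes it as \<open>dF\<close>, and \<open>F\<close> trivializes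
  \<open>\<Phi>\<close> because \<open>\<Phi> - dF = f\<close>.\<close>

lemma trivial_families_eq:
  "trivial_families \<delta> G (Suc m) = {\<Phi> \<in> carrier (family_group \<delta> G (Suc m)).
    family_coboundary \<delta> G (Suc m) \<Phi> \<in> family_coboundary \<delta> G (Suc m) ` finsupp_families \<delta> (Suc m)}"
proof -
  let ?C = "family_group \<delta> G (Suc m)" and ?D = "family_coboundary \<delta> G (Suc m)"
  interpret D: group_hom ?C "family_group \<delta> G (Suc (Suc m))" ?D
    by (rule group_hom_family_coboundary)
  have diff_finsupp: "\<Phi> \<otimes>\<^bsub>?C\<^esub> inv\<^bsub>?C\<^esub> \<Psi> \<in> finsupp_families \<delta> (Suc m) \<longleftrightarrow>
      (\<forall>\<alpha>\<in>tuples \<delta> (Suc m). almost_eq {..<hd \<alpha>} (\<Psi> \<alpha>) (\<Phi> \<alpha>))"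
    if \<Phi>: "\<Phi> \<in> carrier ?C" and \<Psi>: "\<Psi> \<in> carrier ?C" for \<Phi> \<Psi>
  proof -
    have "(\<Phi> \<otimes>\<^bsub>?C\<^esub> inv\<^bsub>?C\<^esub> \<Psi>) \<alpha> \<gamma> = \<one> \<longleftrightarrow> \<Psi> \<alpha> \<gamma> = \<Phi> \<alpha> \<gamma>"
      if "\<alpha> \<in> tuples \<delta> (Suc m)" "\<gamma> < hd \<alpha>" for \<alpha> \<gamma>
    proof -
      have "\<Phi> \<alpha> \<gamma> \<in> carrier G" "\<Psi> \<alpha> \<gamma> \<in> carrier G"
        using \<Phi> \<Psi> that by (auto simp: family_group_iff)
      then show ?thesis
        using that \<Psi> by (simp add: mult_family_group inv_family_group)
          (metis inv_closed inv_equality inv_inv r_inv)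
    qed
    then show ?thesis
      using \<Phi> \<Psi> by (simp add: finsupp_families_iff almost_eq_def cong: conj_cong)
  qed
  have "n_trivial \<delta> G (Suc m) \<Phi> \<longleftrightarrow> ?D \<Phi> \<in> ?D ` finsupp_families \<delta> (Suc m)"
    if \<Phi>: "\<Phi> \<in> carrier ?C" for \<Phi>
  proof
    assume "n_trivial \<delta> G (Suc m) \<Phi>"
    then obtain F where F: "\<And>\<beta> \<gamma>. F \<beta> \<gamma> \<in> carrier G"
        "\<forall>\<alpha>\<in>tuples \<delta> (Suc m). almost_eq {..<hd \<alpha>} (alternating_sum G F \<alpha>) (\<Phi> \<alpha>)"
      by (auto simp: n_trivial_iff)
    let ?\<Psi> = "family_coboundary \<delta> G m F"
    have \<Psi>: "?\<Psi> \<in> carrier ?C"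
      using F(1) by (intro family_coboundary_closed)
    have "\<Phi> \<otimes>\<^bsub>?C\<^esub> inv\<^bsub>?C\<^esub> ?\<Psi> \<in> finsupp_families \<delta> (Suc m)"
      using F(2) by (simp add: diff_finsupp \<Phi> \<Psi> almost_eq_def family_coboundary_apply cong: conj_cong)
    moreover have "?D (\<Phi> \<otimes>\<^bsub>?C\<^esub> inv\<^bsub>?C\<^esub> ?\<Psi>) = ?D \<Phi>"
      using \<Phi> \<Psi> F(1) by (simp add: family_coboundary_square)
    ultimately show "?D \<Phi> \<in> ?D ` finsupp_families \<delta> (Suc m)"
      by (metis image_eqI)
  next
    assume "?D \<Phi> \<in> ?D ` finsupp_families \<delta> (Suc m)"
    then obtain f where f: "f \<in> finsupp_families \<delta> (Suc m)" "?D \<Phi> = ?D f"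
      by blast
    let ?\<Psi> = "\<Phi> \<otimes>\<^bsub>?C\<^esub> inv\<^bsub>?C\<^esub> f"
    have \<Psi>: "?\<Psi> \<in> carrier ?C"
      using \<Phi> finsupp_family[OF f(1)] by simp
    have "?D ?\<Psi> = \<one>\<^bsub>family_group \<delta> G (Suc (Suc m))\<^esub>"
      using \<Phi> finsupp_family[OF f(1)] f(2) by simp
    then obtain F where F: "\<And>\<beta> \<gamma>. F \<beta> \<gamma> \<in> carrier G" "family_coboundary \<delta> G m F = ?\<Psi>"
      using family_coboundary_exact[OF \<Psi>] by blast
    have "\<Phi> \<otimes>\<^bsub>?C\<^esub> inv\<^bsub>?C\<^esub> ?\<Psi> = f"
      using \<Phi> finsupp_family[OF f(1)]
      by (simp add: comm_group.inv_mult[OF comm_group_family_group] flip: D.G.m_assoc)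
    then have "\<forall>\<alpha>\<in>tuples \<delta> (Suc m). almost_eq {..<hd \<alpha>} (family_coboundary \<delta> G m F \<alpha>) (\<Phi> \<alpha>)"
      using f(1) diff_finsupp[OF \<Phi> \<Psi>] F(2) by simp
    then have "\<forall>\<alpha>\<in>tuples \<delta> (Suc m). almost_eq {..<hd \<alpha>} (alternating_sum G F \<alpha>) (\<Phi> \<alpha>)"
      by (simp add: almost_eq_def family_coboundary_apply cong: conj_cong)
    then show "n_trivial \<delta> G (Suc m) \<Phi>"
      using F(1) n_trivial_iff by blast
  qed
  then show ?thesis
    unfolding trivial_families_def by blast
qed


section \<open>Cochains of the presheaf of finitely supported functions\<close>

text \<open>Direct sums and full products share their operations and differ only in the carrier.
  Equality of records lets later facts about families transfer by rewriting.\<close>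

lemma cochains_finsupp:
  "cochains \<delta> initial_segments (finsupp_presheaf G) j =
    (family_group \<delta> G (Suc j))\<lparr>carrier := finsupp_families \<delta> (Suc j)\<rparr>"
  by (rule monoid.equality)
    (auto simp: cochains_def finsupp_presheaf_def family_group_def finsupp_families_def
      cover_meet_initial_segments fun_eq_iff cong: PiE_cong)

lemma comm_group_sum_group: "comm_group (sum_group U (\<lambda>_. G))"
  using abelian_presheaf.comm_group_sections[OF abelian_presheaf_finsupp[OF comm_group_axioms], of U UNIV]
  by (simp add: finsupp_presheaf_def)

text \<open>\<open>differential\<close> sums in the group of sections over the intersection,
  \<open>family_coboundary\<close> sums values in \<open>G\<close>. Evaluation at a point is a
  homomorphism, so it carries the powers and the product of the first to those of the second. Degree
  \<open>j\<close> corresponds to tuple length \<open>Suc j\<close>.\<close>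

lemma differential_finsupp:
  assumes f: "f \<in> finsupp_families \<delta> (Suc j)"
  shows "differential \<delta> initial_segments (finsupp_presheaf G) j f = family_coboundary \<delta> G (Suc j) f"
proof -
  have "Suc j + 1 = j + 2" by simp
  then show ?thesis
    unfolding differential_def family_coboundary_def
  proof (simp only:, intro restrict_ext)
    fix \<alpha> assume "\<alpha> \<in> tuples \<delta> (j + 2)"
    then have \<alpha>: "\<alpha> \<in> tuples \<delta> (Suc (Suc j))" by simp
    define U where "U = {..<hd \<alpha>}"
    define S where "S = sum_group U (\<lambda>_. G)"
    interpret S: comm_group S
      unfolding S_def by (rule comm_group_sum_group)
    have len: "{0..j + 1} = {..<length \<alpha>}"
      using \<alpha> by (auto simp: tuples_def)
    let ?y = "\<lambda>i. restrict (f (face i \<alpha>)) U"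
    have y: "?y i \<in> carrier S" if i: "i < length \<alpha>" for i
    proof -
      have "U \<subseteq> {..<hd (face i \<alpha>)}"
        using hd_le_hd_face[OF \<alpha>, of i] i \<alpha> by (auto simp: U_def tuples_def)
      moreover have "f (face i \<alpha>) \<in> carrier (sum_group {..<hd (face i \<alpha>)} (\<lambda>_. G))"
        using f face_in_tuples[OF \<alpha>, of i] i \<alpha> by (auto simp: finsupp_families_def tuples_def)
      ultimately show ?thesis
        using abelian_presheaf.restr_hom[OF abelian_presheaf_finsupp[OF comm_group_axioms, of UNIV],
            of "{..<hd (face i \<alpha>)}" U]
        by (auto simp: finsupp_presheaf_def S_def dest: hom_in_carrier)
    qed
    have ev: "(\<lambda>g. g \<gamma>) \<in> hom S G" if "\<gamma> \<in> U" for \<gamma>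
      using that by (auto simp: S_def hom_def carrier_sum_group)
    have pow: "(?y i [^]\<^bsub>S\<^esub> e) \<gamma> = f (face i \<alpha>) \<gamma> [^] e"
      if "i < length \<alpha>" "\<gamma> \<in> U" for i \<gamma> and e :: int
      using hom_int_pow[OF ev[OF that(2)] y[OF that(1)] S.is_group is_group, of e] that by simp
    let ?lhs = "\<Otimes>\<^bsub>S\<^esub>i\<in>{..<length \<alpha>}. ?y i [^]\<^bsub>S\<^esub> ((-1) ^ i :: int)"
    have "?lhs = (\<lambda>\<gamma>\<in>U. alternating_sum G f \<alpha> \<gamma>)"
    proof (rule extensionalityI)
      have "?lhs \<in> carrier S"
        using y by (intro S.finprod_closed) auto
      then show "?lhs \<in> extensional U"
        by (simp add: S_def carrier_sum_group PiE_iff)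
      fix \<gamma> assume \<gamma>: "\<gamma> \<in> U"
      have "?lhs \<gamma> = (\<Otimes>i\<in>{..<length \<alpha>}. (?y i [^]\<^bsub>S\<^esub> ((-1) ^ i :: int)) \<gamma>)"
        using y by (intro hom_finprod[OF S.comm_group_axioms comm_group_axioms ev[OF \<gamma>]]) auto
      also have "\<dots> = alternating_sum G f \<alpha> \<gamma>"
        unfolding alternating_sum_def using family_face_closed[OF finsupp_family[OF f] \<alpha> \<gamma>[unfolded U_def lessThan_iff]] \<gamma>
        by (intro finprod_cong') (auto simp: pow)
      finally show "?lhs \<gamma> = (\<lambda>\<gamma>\<in>U. alternating_sum G f \<alpha> \<gamma>) \<gamma>"
        using \<gamma> by simp
    qed auto
    then show "(\<Otimes>\<^bsub>sections (finsupp_presheaf G) (cover_meet initial_segments \<alpha>)\<^esub>i\<in>{0..j + 1}.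
        restr (finsupp_presheaf G) (cover_meet initial_segments (face i \<alpha>)) (cover_meet initial_segments \<alpha>)
          (f (face i \<alpha>))
        [^]\<^bsub>sections (finsupp_presheaf G) (cover_meet initial_segments \<alpha>)\<^esub> ((-1) ^ i :: int))
      = (\<lambda>\<gamma>\<in>{..<hd \<alpha>}. alternating_sum G f \<alpha> \<gamma>)"
      unfolding len cover_meet_initial_segments[OF \<alpha>]
      by (simp add: finsupp_presheaf_def S_def U_def)
  qed
qed

text \<open>The support over \<open>\<alpha>\<close> lies in the union of the finitely many supports
  over its faces.\<close>

lemma family_coboundary_finsupp:
  assumes f: "f \<in> finsupp_families \<delta> (Suc m)"
  shows "family_coboundary \<delta> G (Suc m) f \<in> finsupp_families \<delta> (Suc (Suc m))"
proof -
  have fam: "f \<in> carrier (family_group \<delta> G (Suc m))"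
    and fin: "\<And>\<alpha>. \<alpha> \<in> tuples \<delta> (Suc m) \<Longrightarrow> finite {\<gamma> \<in> {..<hd \<alpha>}. f \<alpha> \<gamma> \<noteq> \<one>}"
    using f by (auto simp: finsupp_families_iff almost_eq_def)
  have "finite {\<gamma> \<in> {..<hd \<alpha>}. alternating_sum G f \<alpha> \<gamma> \<noteq> \<one>}"
    if \<alpha>: "\<alpha> \<in> tuples \<delta> (Suc (Suc m))" for \<alpha>
  proof (rule finite_subset)
    let ?S = "\<lambda>i. {\<gamma> \<in> {..<hd (face i \<alpha>)}. f (face i \<alpha>) \<gamma> \<noteq> \<one>}"
    show "{\<gamma> \<in> {..<hd \<alpha>}. alternating_sum G f \<alpha> \<gamma> \<noteq> \<one>} \<subseteq> (\<Union>i<length \<alpha>. ?S i)"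
    proof (rule subsetI, rule ccontr)
      fix \<gamma> assume "\<gamma> \<in> {\<gamma> \<in> {..<hd \<alpha>}. alternating_sum G f \<alpha> \<gamma> \<noteq> \<one>}"
        and notin: "\<gamma> \<notin> (\<Union>i<length \<alpha>. ?S i)"
      then have \<gamma>: "\<gamma> < hd \<alpha>" and ne: "alternating_sum G f \<alpha> \<gamma> \<noteq> \<one>"
        by auto
      have "alternating_sum G f \<alpha> \<gamma> = alternating_sum G (\<lambda>_ _. \<one>) \<alpha> \<gamma>"
        by (rule alternating_sum_cong) (use notin face_tuples[OF \<alpha> \<gamma>] in auto)
      with ne show False
        by (simp add: alternating_sum_one)
    qed
    show "finite (\<Union>i<length \<alpha>. ?S i)"
      using face_in_tuples[OF \<alpha>] fin \<alpha> by (intro finite_UN_I) (auto simp: tuples_def[of _ "Suc (Suc m)"])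
  qed
  then show ?thesis
    using hom_in_carrier[OF family_coboundary_hom fam]
    by (simp add: finsupp_families_iff almost_eq_def family_coboundary_apply cong: conj_cong)
qed

lemma cocycle_group_finsupp:
  "cocycle_group \<delta> initial_segments (finsupp_presheaf G) n = (family_group \<delta> G (Suc n))\<lparr>carrier :=
    {f \<in> finsupp_families \<delta> (Suc n).
      family_coboundary \<delta> G (Suc n) f = \<one>\<^bsub>family_group \<delta> G (Suc (Suc n))\<^esub>}\<rparr>"
  by (simp add: cocycle_group_def cochains_finsupp kernel_def differential_finsupp cong: conj_cong)

lemma coboundaries_finsupp:
  "coboundaries \<delta> initial_segments (finsupp_presheaf G) (Suc m) =
    family_coboundary \<delta> G (Suc m) ` finsupp_families \<delta> (Suc m)"
  by (auto simp: coboundaries_def cochains_finsupp differential_finsupp)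

section \<open>Coherent families, cocycles and the connecting isomorphism\<close>

lemma comm_group_coherent_group: "comm_group (coherent_group \<delta> G (Suc m))"
proof -
  interpret C: comm_group "family_group \<delta> G (Suc m)"
    by (rule comm_group_family_group)
  \<comment> \<open>Coherent families are the preimage of the finitely supported ones under the
    coboundary.\<close>
  have "subgroup {\<Phi> \<in> carrier (family_group \<delta> G (Suc m)). n_coherent \<delta> G (Suc m) \<Phi>}
      (family_group \<delta> G (Suc m))"
    using group_hom.subgroup_vimage[OF group_hom_family_coboundary subgroup_finsupp_families]
    by (simp add: n_coherent_iff cong: conj_cong)
  then show ?thesis
    unfolding coherent_group_def by (rule C.comm_group_carrier_update)
qed

lemma subgroup_cocycles:
  "subgroup (carrier (cocycle_group \<delta> initial_segments (finsupp_presheaf G) n)) (family_group \<delta> G (Suc n))"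
proof -
  interpret C: comm_group "family_group \<delta> G (Suc n)"
    by (rule comm_group_family_group)
  have "carrier (cocycle_group \<delta> initial_segments (finsupp_presheaf G) n) = finsupp_families \<delta> (Suc n)
      \<inter> kernel (family_group \<delta> G (Suc n)) (family_group \<delta> G (Suc (Suc n))) (family_coboundary \<delta> G (Suc n))"
    by (auto simp: cocycle_group_finsupp kernel_def finsupp_families_iff)
  then show ?thesis
    using C.subgroups_Inter_pair[OF subgroup_finsupp_families
        group_hom.subgroup_kernel[OF group_hom_family_coboundary]] by simp
qed

lemma comm_group_cocycle_group:
  "comm_group (cocycle_group \<delta> initial_segments (finsupp_presheaf G) n)"
  using comm_group.comm_group_carrier_update[OF comm_group_family_group subgroup_cocycles, of \<delta> n]
  by (simp add: cocycle_group_finsupp)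

lemma family_coboundary_family_coboundary:
  assumes "\<Phi> \<in> carrier (family_group \<delta> G (Suc m))"
  shows "family_coboundary \<delta> G (Suc (Suc m)) (family_coboundary \<delta> G (Suc m) \<Phi>)
    = \<one>\<^bsub>family_group \<delta> G (Suc (Suc (Suc m)))\<^esub>"
  using family_coboundary_square[of "extend_by_one \<Phi>" \<delta> "Suc m"]
  by (simp add: family_coboundary_extend_by_one assms extend_by_one_closed)

lemma coherent_coboundary_surj:
  "family_coboundary \<delta> G (Suc m) ` carrier (coherent_group \<delta> G (Suc m))
    = carrier (cocycle_group \<delta> initial_segments (finsupp_presheaf G) (Suc m))"
proof (intro equalityI subsetI)
  fix f assume "f \<in> family_coboundary \<delta> G (Suc m) ` carrier (coherent_group \<delta> G (Suc m))"
  then show "f \<in> carrier (cocycle_group \<delta> initial_segments (finsupp_presheaf G) (Suc m))"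
    by (auto simp: coherent_group_def cocycle_group_finsupp n_coherent_iff family_coboundary_family_coboundary)
next
  fix f assume "f \<in> carrier (cocycle_group \<delta> initial_segments (finsupp_presheaf G) (Suc m))"
  then have f: "f \<in> finsupp_families \<delta> (Suc (Suc m))" "f \<in> carrier (family_group \<delta> G (Suc (Suc m)))"
      "family_coboundary \<delta> G (Suc (Suc m)) f = \<one>\<^bsub>family_group \<delta> G (Suc (Suc (Suc m)))\<^esub>"
    by (auto simp: cocycle_group_finsupp finsupp_families_iff)
  obtain F where F: "\<And>\<beta> \<gamma>. F \<beta> \<gamma> \<in> carrier G" "family_coboundary \<delta> G (Suc m) F = f"
    using family_coboundary_exact[OF f(2,3)] by blast
  \<comment> \<open>The lift \<open>F\<close> need not be extensional; its truncation is a family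
    with the same coboundary \<open>f\<close>, and is coherent since \<open>f\<close> has finite
    supports.\<close>
  show "f \<in> family_coboundary \<delta> G (Suc m) ` carrier (coherent_group \<delta> G (Suc m))"
    using family_coboundary_restrict[OF F(1), of \<delta> m] F(2) f(1)
    by (intro image_eqI[of _ _ "restrict_family \<delta> (Suc m) F"])
      (auto simp: coherent_group_def n_coherent_iff)
qed

lemma group_hom_coherent_coboundary:
  "group_hom (coherent_group \<delta> G (Suc m))
    (cocycle_group \<delta> initial_segments (finsupp_presheaf G) (Suc m)) (family_coboundary \<delta> G (Suc m))"
proof (intro group_hom.intro group_hom_axioms.intro homI)
  fix \<Phi> \<Psi>
  assume "\<Phi> \<in> carrier (coherent_group \<delta> G (Suc m))" "\<Psi> \<in> carrier (coherent_group \<delta> G (Suc m))"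
  then show "family_coboundary \<delta> G (Suc m) (\<Phi> \<otimes>\<^bsub>coherent_group \<delta> G (Suc m)\<^esub> \<Psi>) =
      family_coboundary \<delta> G (Suc m) \<Phi>
        \<otimes>\<^bsub>cocycle_group \<delta> initial_segments (finsupp_presheaf G) (Suc m)\<^esub> family_coboundary \<delta> G (Suc m) \<Psi>"
    using hom_mult[OF family_coboundary_hom, of \<Phi> \<delta> m \<Psi>]
    by (simp add: coherent_group_def cocycle_group_finsupp)
qed (use coherent_coboundary_surj in \<open>auto intro: comm_group.axioms(2)
  comm_group_coherent_group comm_group_cocycle_group\<close>)

lemma subgroup_coboundaries:
  "subgroup (coboundaries \<delta> initial_segments (finsupp_presheaf G) (Suc m))
    (cocycle_group \<delta> initial_segments (finsupp_presheaf G) (Suc m))"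
proof -
  let ?Z = "cocycle_group \<delta> initial_segments (finsupp_presheaf G) (Suc m)"
  interpret C: comm_group "family_group \<delta> G (Suc (Suc m))"
    by (rule comm_group_family_group)
  \<comment> \<open>Finitely supported families are coherent, so their coboundaries are already
    known to be cocycles.\<close>
  have "finsupp_families \<delta> (Suc m) \<subseteq> carrier (coherent_group \<delta> G (Suc m))"
    by (auto simp: coherent_group_def n_coherent_iff family_coboundary_finsupp finsupp_family)
  then have "coboundaries \<delta> initial_segments (finsupp_presheaf G) (Suc m) \<subseteq> carrier ?Z"
    unfolding coboundaries_finsupp using coherent_coboundary_surj by blast
  moreover have "subgroup (coboundaries \<delta> initial_segments (finsupp_presheaf G) (Suc m))
      (family_group \<delta> G (Suc (Suc m)))"
    unfolding coboundaries_finsupp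
    by (rule group_hom.subgroup_img_is_subgroup[OF group_hom_family_coboundary subgroup_finsupp_families])
  ultimately have "subgroup (coboundaries \<delta> initial_segments (finsupp_presheaf G) (Suc m))
      ((family_group \<delta> G (Suc (Suc m)))\<lparr>carrier := carrier ?Z\<rparr>)"
    using C.subgroup_incl subgroup_cocycles by blast
  then show ?thesis
    by (simp add: cocycle_group_finsupp)
qed

text \<open>Puts trivial families in the form of the kernel in \<open>induced_iso\<close>.
  Coboundaries of cochains have finite supports, so a family whose coboundary is one of them is
  automatically coherent.\<close>

lemma trivial_families_vimage:
  "trivial_families \<delta> G (Suc m) = {\<Phi> \<in> carrier (coherent_group \<delta> G (Suc m)).
    family_coboundary \<delta> G (Suc m) \<Phi> \<in> coboundaries \<delta> initial_segments (finsupp_presheaf G) (Suc m)}"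
proof -
  have "n_coherent \<delta> G (Suc m) \<Phi>" if "\<Phi> \<in> carrier (family_group \<delta> G (Suc m))"
      "family_coboundary \<delta> G (Suc m) \<Phi> \<in> coboundaries \<delta> initial_segments (finsupp_presheaf G) (Suc m)" for \<Phi>
    using that subgroup.subset[OF subgroup_coboundaries[of \<delta> m]]
    by (auto simp: n_coherent_iff cocycle_group_finsupp)
  then show ?thesis
    by (auto simp: trivial_families_eq coboundaries_finsupp coherent_group_def)
qed

lemma subgroup_trivial_families:
  "subgroup (trivial_families \<delta> G (Suc m)) (coherent_group \<delta> G (Suc m))"
  unfolding trivial_families_vimage
  by (rule group_hom.subgroup_vimage[OF group_hom_coherent_coboundary subgroup_coboundaries])

lemma connecting_map_iso:
  "connecting_map \<delta> G (Suc m) \<in> iso (coherent_mod_trivial \<delta> G (Suc m))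
    (cohomology \<delta> initial_segments (finsupp_presheaf G) (Suc m))"
  unfolding connecting_map_def coherent_mod_trivial_def cohomology_def trivial_families_vimage
  by (intro group_hom.induced_iso[OF group_hom_coherent_coboundary] coherent_coboundary_surj
    comm_group.subgroup_imp_normal[OF comm_group_cocycle_group] subgroup_coboundaries)

text \<open>Evaluates the connecting map on representatives, as the naturality square
  requires.\<close>

lemma connecting_map_coset:
  assumes "\<Phi> \<in> carrier (coherent_group \<delta> G (Suc m))"
  shows "connecting_map \<delta> G (Suc m) (trivial_families \<delta> G (Suc m) #>\<^bsub>coherent_group \<delta> G (Suc m)\<^esub> \<Phi>) =
    coboundaries \<delta> initial_segments (finsupp_presheaf G) (Suc m)
      #>\<^bsub>cocycle_group \<delta> initial_segments (finsupp_presheaf G) (Suc m)\<^esub> family_coboundary \<delta> G (Suc m) \<Phi>"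
  unfolding connecting_map_def
  by (rule group_hom.induced_coset[OF group_hom_coherent_coboundary subgroup_coboundaries _ _ _ assms])
    (use subgroup.one_closed[OF subgroup_trivial_families] in \<open>auto simp: trivial_families_vimage\<close>)

end


section \<open>Change of coefficients\<close>

lemma family_coboundary_map:
  assumes A: "comm_group A" and B: "comm_group B" and h: "h \<in> hom A B"
    and \<Phi>: "\<Phi> \<in> carrier (family_group \<delta> A (Suc m))"
  shows "family_coboundary \<delta> B (Suc m) (restrict_family \<delta> (Suc m) (\<lambda>\<alpha> \<gamma>. h (\<Phi> \<alpha> \<gamma>)))
    = restrict_family \<delta> (Suc (Suc m)) (\<lambda>\<alpha> \<gamma>. h (family_coboundary \<delta> A (Suc m) \<Phi> \<alpha> \<gamma>))"
proof -
  interpret A: comm_group A by fact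
  interpret B: comm_group B by fact
  have "alternating_sum B (restrict_family \<delta> (Suc m) (\<lambda>\<alpha> \<gamma>. h (\<Phi> \<alpha> \<gamma>))) \<alpha> \<gamma>
      = h (alternating_sum A \<Phi> \<alpha> \<gamma>)"
    if \<alpha>: "\<alpha> \<in> tuples \<delta> (Suc (Suc m))" and \<gamma>: "\<gamma> < hd \<alpha>" for \<alpha> \<gamma>
  proof -
    note face = A.family_face_closed[OF \<Phi> \<alpha> \<gamma>]
    have "h (alternating_sum A \<Phi> \<alpha> \<gamma>)
        = finprod B (\<lambda>i. h (\<Phi> (face i \<alpha>) \<gamma> [^]\<^bsub>A\<^esub> ((-1) ^ i :: int))) {..<length \<alpha>}"
      unfolding alternating_sum_def using face by (intro hom_finprod[OF A B h]) auto
    also have "\<dots> = alternating_sum B (restrict_family \<delta> (Suc m) (\<lambda>\<alpha> \<gamma>. h (\<Phi> \<alpha> \<gamma>))) \<alpha> \<gamma>"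
      unfolding alternating_sum_def
      by (rule B.finprod_cong') (use face face_tuples[OF \<alpha> \<gamma>] h in
        \<open>auto simp: restrict_family_def hom_int_pow A.is_group B.is_group hom_in_carrier\<close>)
    finally show ?thesis by simp
  qed
  then show ?thesis
    by (simp add: family_coboundary_def restrict_family_def[of _ "Suc (Suc m)"] cong: restrict_cong)
qed

text \<open>A homomorphism fixes the neutral element, so supports can only shrink.\<close>

lemma restrict_family_finsupp:
  assumes A: "comm_group A" and B: "comm_group B" and h: "h \<in> hom A B"
    and f: "f \<in> comm_group.finsupp_families A \<delta> n"
  shows "restrict_family \<delta> n (\<lambda>\<alpha> \<gamma>. h (f \<alpha> \<gamma>)) \<in> comm_group.finsupp_families B \<delta> n"
proof -
  interpret A: comm_group A by fact
  interpret B: comm_group B by fact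
  have "h \<one>\<^bsub>A\<^esub> = \<one>\<^bsub>B\<^esub>"
    using hom_one[OF h A.is_group B.is_group] .
  then have "finite {\<gamma> \<in> {..<hd \<alpha>}. h (f \<alpha> \<gamma>) \<noteq> \<one>\<^bsub>B\<^esub>}" if "\<alpha> \<in> tuples \<delta> n" for \<alpha>
    using f that
    by (auto simp: A.finsupp_families_iff almost_eq_def elim!: rev_finite_subset dest!: bspec[of _ _ \<alpha>])
  moreover have "restrict_family \<delta> n (\<lambda>\<alpha> \<gamma>. h (f \<alpha> \<gamma>)) \<in> carrier (family_group \<delta> B n)"
    using f h by (auto simp: A.finsupp_families_iff A.family_group_iff B.family_group_iff
      restrict_family_def hom_in_carrier)
  ultimately show ?thesis
    by (simp add: B.finsupp_families_iff almost_eq_def restrict_family_def cong: conj_cong)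
qed

lemma restrict_family_hom:
  assumes A: "comm_group A" and B: "comm_group B" and h: "h \<in> hom A B"
  shows "(\<lambda>\<Phi>. restrict_family \<delta> n (\<lambda>\<alpha> \<gamma>. h (\<Phi> \<alpha> \<gamma>))) \<in> hom (family_group \<delta> A n) (family_group \<delta> B n)"
proof (rule homI)
  interpret A: comm_group A by fact
  interpret B: comm_group B by fact
  fix \<Phi> assume \<Phi>: "\<Phi> \<in> carrier (family_group \<delta> A n)"
  then show "restrict_family \<delta> n (\<lambda>\<alpha> \<gamma>. h (\<Phi> \<alpha> \<gamma>)) \<in> carrier (family_group \<delta> B n)"
    using h by (auto simp: A.family_group_iff B.family_group_iff restrict_family_def hom_in_carrier)
  fix \<Psi> assume "\<Psi> \<in> carrier (family_group \<delta> A n)"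
  then have "h (\<Phi> \<alpha> \<gamma> \<otimes>\<^bsub>A\<^esub> \<Psi> \<alpha> \<gamma>) = h (\<Phi> \<alpha> \<gamma>) \<otimes>\<^bsub>B\<^esub> h (\<Psi> \<alpha> \<gamma>)"
    if "\<alpha> \<in> tuples \<delta> n" "\<gamma> < hd \<alpha>" for \<alpha> \<gamma>
    using \<Phi> that hom_mult[OF h] by (simp add: A.family_group_iff)
  then show "restrict_family \<delta> n (\<lambda>\<alpha> \<gamma>. h ((\<Phi> \<otimes>\<^bsub>family_group \<delta> A n\<^esub> \<Psi>) \<alpha> \<gamma>)) =
      restrict_family \<delta> n (\<lambda>\<alpha> \<gamma>. h (\<Phi> \<alpha> \<gamma>))
        \<otimes>\<^bsub>family_group \<delta> B n\<^esub> restrict_family \<delta> n (\<lambda>\<alpha> \<gamma>. h (\<Psi> \<alpha> \<gamma>))"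
    by (auto simp: restrict_family_def family_group_def fun_eq_iff)
qed

lemma restrict_family_one:
  assumes "comm_group A" and "comm_group B" and "h \<in> hom A B"
  shows "restrict_family \<delta> n (\<lambda>\<alpha> \<gamma>. h (\<one>\<^bsub>family_group \<delta> A n\<^esub> \<alpha> \<gamma>)) = \<one>\<^bsub>family_group \<delta> B n\<^esub>"
  using hom_one[OF restrict_family_hom[OF assms]] assms
  by (simp add: comm_group.axioms(2) comm_group.comm_group_family_group)

text \<open>On the coset of \<open>\<Phi>\<close> the square reduces to
  \<open>family_coboundary_map\<close>: applying \<open>h\<close> commutes with the coboundary. The
  rest checks that every map is well defined on cosets.\<close>

lemma connecting_map_natural:
  assumes A: "comm_group A" and B: "comm_group B" and h: "h \<in> hom A B"
    and X: "X \<in> carrier (coherent_mod_trivial \<delta> A (Suc m))"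
  shows "cohomology_coeff_map \<delta> B (Suc m) h (connecting_map \<delta> A (Suc m) X)
    = connecting_map \<delta> B (Suc m) (families_coeff_map \<delta> B (Suc m) h X)"
proof -
  let ?n = "Suc m"
  let ?F = "\<lambda>n \<Phi>. restrict_family \<delta> n (\<lambda>\<alpha> \<gamma>. h (\<Phi> \<alpha> \<gamma>))"
  interpret A: comm_group A by fact
  interpret B: comm_group B by fact
  note map = family_coboundary_map[OF A B h] and finsupp = restrict_family_finsupp[OF A B h]
    and hom = restrict_family_hom[OF A B h]
  have coherent: "?F ?n \<Phi> \<in> carrier (coherent_group \<delta> B ?n)"
    if "\<Phi> \<in> carrier (coherent_group \<delta> A ?n)" for \<Phi>
    using that hom_in_carrier[OF hom[of \<delta> ?n]] finsupp
    by (auto simp: coherent_group_def A.n_coherent_iff B.n_coherent_iff map)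
  have cocycle: "?F (Suc ?n) f \<in> carrier (cocycle_group \<delta> initial_segments (finsupp_presheaf B) ?n)"
    if "f \<in> carrier (cocycle_group \<delta> initial_segments (finsupp_presheaf A) ?n)" for f
    using that finsupp
    by (auto simp: A.cocycle_group_finsupp B.cocycle_group_finsupp A.finsupp_family map
      restrict_family_one[OF A B h])
  have coboundary: "?F (Suc ?n) ` coboundaries \<delta> initial_segments (finsupp_presheaf A) ?n
      \<subseteq> coboundaries \<delta> initial_segments (finsupp_presheaf B) ?n"
    using finsupp by (auto simp: A.coboundaries_finsupp B.coboundaries_finsupp A.finsupp_family
      simp flip: map intro!: imageI)
  \<comment> \<open>Triviality passes through its description by coboundaries, so no trivializing
    function has to be transported.\<close>
  have trivial: "?F ?n ` trivial_families \<delta> A ?n \<subseteq> trivial_families \<delta> B ?n"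
    using coherent coboundary
    by (auto simp: A.trivial_families_vimage B.trivial_families_vimage coherent_group_def map)
  have hom_families: "group_hom (coherent_group \<delta> A ?n) (coherent_group \<delta> B ?n) (?F ?n)"
  proof (intro group_hom.intro group_hom_axioms.intro homI)
    fix \<Phi> \<Psi> assume "\<Phi> \<in> carrier (coherent_group \<delta> A ?n)" "\<Psi> \<in> carrier (coherent_group \<delta> A ?n)"
    then show "?F ?n (\<Phi> \<otimes>\<^bsub>coherent_group \<delta> A ?n\<^esub> \<Psi>) = ?F ?n \<Phi> \<otimes>\<^bsub>coherent_group \<delta> B ?n\<^esub> ?F ?n \<Psi>"
      using hom_mult[OF hom, of \<Phi> \<delta> ?n \<Psi>] by (simp add: coherent_group_def)
  qed (use coherent in \<open>auto intro: comm_group.axioms(2) A.comm_group_coherent_group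
    B.comm_group_coherent_group\<close>)
  have hom_cocycles: "group_hom (cocycle_group \<delta> initial_segments (finsupp_presheaf A) ?n)
      (cocycle_group \<delta> initial_segments (finsupp_presheaf B) ?n) (?F (Suc ?n))"
  proof (intro group_hom.intro group_hom_axioms.intro homI)
    fix f g assume "f \<in> carrier (cocycle_group \<delta> initial_segments (finsupp_presheaf A) ?n)"
      "g \<in> carrier (cocycle_group \<delta> initial_segments (finsupp_presheaf A) ?n)"
    then show "?F (Suc ?n) (f \<otimes>\<^bsub>cocycle_group \<delta> initial_segments (finsupp_presheaf A) ?n\<^esub> g) =
        ?F (Suc ?n) f \<otimes>\<^bsub>cocycle_group \<delta> initial_segments (finsupp_presheaf B) ?n\<^esub> ?F (Suc ?n) g"
      using hom_mult[OF hom, of f \<delta> "Suc ?n" g]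
      by (simp add: A.cocycle_group_finsupp B.cocycle_group_finsupp A.finsupp_family)
  qed (use cocycle in \<open>auto intro: comm_group.axioms(2) A.comm_group_cocycle_group
    B.comm_group_cocycle_group\<close>)
  \<comment> \<open>The coefficient map restricts to \<open>cover_meet\<close>, the truncation to
    \<open>{..<hd \<alpha>}\<close>; on nonempty tuples these domains agree.\<close>
  have cohomology_map: "cohomology_coeff_map \<delta> B ?n h =
      induced (cocycle_group \<delta> initial_segments (finsupp_presheaf B) ?n)
        (coboundaries \<delta> initial_segments (finsupp_presheaf B) ?n) (?F (Suc ?n))"
    unfolding cohomology_coeff_map_def restrict_family_def
    by (intro arg_cong[of _ _ "induced _ _"] ext restrict_cong) (auto simp: cover_meet_initial_segments)
  have families_map: "families_coeff_map \<delta> B ?n h =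
      induced (coherent_group \<delta> B ?n) (trivial_families \<delta> B ?n) (?F ?n)"
    by (simp add: families_coeff_map_def restrict_family_def)
  obtain \<Phi> where \<Phi>: "\<Phi> \<in> carrier (coherent_group \<delta> A ?n)"
    and X_eq: "X = trivial_families \<delta> A ?n #>\<^bsub>coherent_group \<delta> A ?n\<^esub> \<Phi>"
    using X by (auto simp: coherent_mod_trivial_def FactGroup_def RCOSETS_def)
  have D\<Phi>: "family_coboundary \<delta> A ?n \<Phi> \<in> carrier (cocycle_group \<delta> initial_segments (finsupp_presheaf A) ?n)"
    using \<Phi> A.coherent_coboundary_surj by blast
  have "cohomology_coeff_map \<delta> B ?n h (connecting_map \<delta> A ?n X) =
      coboundaries \<delta> initial_segments (finsupp_presheaf B) ?n
        #>\<^bsub>cocycle_group \<delta> initial_segments (finsupp_presheaf B) ?n\<^esub>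
          ?F (Suc ?n) (family_coboundary \<delta> A ?n \<Phi>)"
    unfolding cohomology_map X_eq A.connecting_map_coset[OF \<Phi>]
    using subgroup.subset[OF A.subgroup_coboundaries] subgroup.one_closed[OF A.subgroup_coboundaries]
    by (intro group_hom.induced_coset[OF hom_cocycles B.subgroup_coboundaries] coboundary D\<Phi>) auto
  also have "?F (Suc ?n) (family_coboundary \<delta> A ?n \<Phi>) = family_coboundary \<delta> B ?n (?F ?n \<Phi>)"
    using \<Phi> by (simp add: coherent_group_def map)
  also have "coboundaries \<delta> initial_segments (finsupp_presheaf B) ?n
        #>\<^bsub>cocycle_group \<delta> initial_segments (finsupp_presheaf B) ?n\<^esub> \<dots>
      = connecting_map \<delta> B ?n (trivial_families \<delta> B ?n #>\<^bsub>coherent_group \<delta> B ?n\<^esub> ?F ?n \<Phi>)"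
    by (rule B.connecting_map_coset[OF coherent[OF \<Phi>], symmetric])
  also have "trivial_families \<delta> B ?n #>\<^bsub>coherent_group \<delta> B ?n\<^esub> ?F ?n \<Phi> = families_coeff_map \<delta> B ?n h X"
    unfolding families_map X_eq
    using subgroup.subset[OF A.subgroup_trivial_families] subgroup.one_closed[OF A.subgroup_trivial_families]
    by (intro group_hom.induced_coset[OF hom_families B.subgroup_trivial_families, symmetric] trivial \<Phi>) auto
  finally show ?thesis .
qed

theorem theorem2p28:
  fixes \<delta> :: "'o::wellorder" and A :: "('a, 'm) monoid_scheme" and n :: nat
  assumes "uncountable_cofinality \<delta>" and "comm_group A" and "n > 0"
  shows "comm_group (coherent_group \<delta> A n)
    \<and> subgroup (trivial_families \<delta> A n) (coherent_group \<delta> A n)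
    \<and> connecting_map \<delta> A n
        \<in> iso (coherent_mod_trivial \<delta> A n) (cohomology \<delta> initial_segments (finsupp_presheaf A) n)
    \<and> (\<forall>(B :: ('b, 'k) monoid_scheme) h X.
          comm_group B \<longrightarrow> h \<in> hom A B \<longrightarrow> X \<in> carrier (coherent_mod_trivial \<delta> A n) \<longrightarrow>
          cohomology_coeff_map \<delta> B n h (connecting_map \<delta> A n X)
            = connecting_map \<delta> B n (families_coeff_map \<delta> B n h X))"
proof -
  interpret A: comm_group A by fact
  obtain m where n: "n = Suc m"
    using \<open>n > 0\<close> gr0_conv_Suc by blast
  show ?thesis
    unfolding n using A.comm_group_coherent_group A.subgroup_trivial_families A.connecting_map_iso
      connecting_map_natural[OF A.comm_group_axioms] by blast
qed

end
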